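(* Let $\Omega\subset\mathbb{R}^N$ be a bounded $C^1$-domain, and let $\mathcal{I}(u,x)=\int_{\mathbb{R}^N}[u(x+z)-u(x)]\,\nu_x(dz)$ satisfy assumptions (M0), (M1), (M2) of the context with the same $\sigma\in(0,1)$. Let $m>1$, $b_0>0$, $A_0\ge0$. Let $u$ be a bounded viscosity subsolution to $$-\mathcal{I}(u,x)+b_0|Du|^m=A_0\quad\text{in }\Omega,$$ and define $\tilde u(x)=u(x)$ if $x\in\Omega$ and $\tilde u(x)=\limsup_{y\to x,\,y\in\Omega}u(y)$ if $x\in\partial\Omega$. Then there exists $C>0$ depending only on the data such that $$\mathrm{osc}_{\bar\Omega}(\tilde u)\le C.$$
   Context: Notation: $d(x)=\mathrm{dist}(x,\partial\Omega)$, $B_r(x)$ is the open ball, $B_r=B_r(0)$, $B_r^c$ its complement. "$C^1$-domain" means that the boundary is $C^1$, with the convention that there is $\delta_0>0$ such that $d$ is of class $C^1$ in $\{x\in\Omega:d(x)<\delta_0\}$. $\mathrm{osc}_{\bar\Omega}(u)=\sup_{\bar\Omega}u-\inf_{\bar\Omega}u$. "The data" means $N,\Omega,\sigma,m,b_0,A_0$ and the constants $C_1,C_2$ below (in particular not $u$). For each $x\in\bar\Omega$, $\nu_x$ is a nonnegative regular measure on $\mathbb{R}^N$. For $D\subset\mathbb{R}^N$, $\mathcal{I}[D](u,y)=\int_D[u(y+z)-u(y)]\nu_y(dz)$. (M0): (M0-1) $\bigcup_{x\in\bar\Omega}\{x+\mathrm{supp}\,\nu_x\}\subseteq\bar\Omega$.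 (M0-2) if $x\in\bar\Omega$, $r>0$ and $u\in L^\infty(\bar\Omega)$ is $C^1$ in $B_r(x)$ (i.e. in $B_r(x)\cap\bar\Omega$), then $\mathcal{I}(u,x)$ is well defined, and for any $D\subset\mathbb{R}^N$ the map $y\mapsto\mathcal{I}[D](u,y)$ is continuous in $B_r(x)$ (i.e. in $B_r(x)\cap\bar\Omega$). (M1): there is $C_1>0$ such that for all $\beta\in[0,2]$ and $\delta>0$, $\sup_{x\in\bar\Omega}\int_{B_\delta^c}\min\{1,|z|^\beta\}\nu_x(dz)\le C_1h_{\beta,\sigma}(\delta)$, where $h_{\beta,\sigma}(\delta)=\delta^{\beta-\sigma}$ if $\beta<\sigma$, $=|\ln\delta|+1$ if $\beta=\sigma$, $=1$ if $\beta>\sigma$ (convention $|z|^0=1$). (M2): there is $C_2>0$ such that for all $\beta\in(\sigma,2]$ and $\delta\in(0,1)$, $\sup_{x\in\bar\Omega}\int_{B_\delta}|z|^\beta\nu_x(dz)\le C_2\delta^{\beta-\sigma}$. Viscosity subsolution in $\Omega$: an upper semicontinuous $u:\bar\Omega\to\mathbb{R}$ such that whenever $\phi\in C^1(\bar\Omega)$ and $u-\phi$ has a maximum on $\bar\Omega$ at $x_0\in\Omega$, then for all $\delta>0$, $-\mathcal{I}[B_\delta](\phi,x_0)-\mathcal{I}[B_\delta^c](u,x_0)+b_0|D\phi(x_0)|^m\le A_0$. *)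

theory Defs
  imports "HOL-Analysis.Analysis"
begin

text \<open>
  Continuously differentiable on a set that need not be open: derivatives are taken
  relative to the set. It is used for relatively open subsets of the closure of a
  \<open>C\<^sup>1\<close> domain; at interior points \<open>g x\<close> is the usual gradient.
\<close>

definition C1_on :: "'a::euclidean_space set \<Rightarrow> ('a \<Rightarrow> real) \<Rightarrow> bool" where
  "C1_on S f \<longleftrightarrow>
     (\<exists>g. continuous_on S g \<and>
          (\<forall>x\<in>S. (f has_derivative (\<lambda>h. h \<bullet> g x)) (at x within S)))"

definition usc_on :: "'a::euclidean_space set \<Rightarrow> ('a \<Rightarrow> real) \<Rightarrow> bool" where
  "usc_on S u \<longleftrightarrow> (\<forall>x\<in>S. \<forall>c>u x. \<forall>\<^sub>F y in at x within S. u y < c)"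

definition osc :: "'a set \<Rightarrow> ('a \<Rightarrow> real) \<Rightarrow> real" where
  "osc S u = (SUP x\<in>S. u x) - (INF x\<in>S. u x)"

text \<open>
  Near each boundary point, \<open>\<Omega>\<close> is the strict epigraph of a \<open>C\<^sup>1\<close> function in some
  orthonormal frame with last vector \<open>e\<close>. The graph function matters only on the
  hyperplane orthogonal to \<open>e\<close>; composition with the projection onto that hyperplane
  extends it to the whole space.
\<close>

definition C1_boundary :: "'a::euclidean_space set \<Rightarrow> bool" where
  "C1_boundary \<Omega> \<longleftrightarrow>
     (\<forall>x\<in>frontier \<Omega>. \<exists>r>0. \<exists>e \<gamma>. norm e = 1 \<and> C1_on UNIV \<gamma> \<and>
        \<Omega> \<inter> ball x r = {y \<in> ball x r. \<gamma> (y - (y \<bullet> e) *\<^sub>R e) < y \<bullet> e})"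

text \<open>
  The last conjunct is not implied by \<open>C1_boundary\<close>: it is the additional convention
  that the distance to the boundary is \<open>C\<^sup>1\<close> near the boundary.
\<close>

definition C1_domain :: "'a::euclidean_space set \<Rightarrow> bool" where
  "C1_domain \<Omega> \<longleftrightarrow>
     open \<Omega> \<and> connected \<Omega> \<and> \<Omega> \<noteq> {} \<and> C1_boundary \<Omega> \<and>
     (\<exists>\<delta>\<^sub>0>0. C1_on {x \<in> \<Omega>. infdist x (frontier \<Omega>) < \<delta>\<^sub>0}
                 (\<lambda>x. infdist x (frontier \<Omega>)))"

definition measure_supp :: "'a::topological_space measure \<Rightarrow> 'a set" where
  "measure_supp M = {z. \<forall>U. open U \<and> z \<in> U \<longrightarrow> emeasure M U > 0}"

text \<open>
  Regularity is required away from the origin, because the measures may have infinite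
  mass in every neighbourhood of \<open>0\<close> (for example the density \<open>norm z powr (- N - \<sigma>)\<close>),
  and are then neither finite on compact sets containing \<open>0\<close> nor outer regular at
  \<open>{0}\<close>. The mass of \<open>{0}\<close> itself is irrelevant to the operator, whose integrand
  vanishes there.
\<close>

definition regular_jump_measure :: "'a::euclidean_space measure \<Rightarrow> bool" where
  "regular_jump_measure M \<longleftrightarrow>
     sets M = sets borel \<and>
     (\<forall>K. compact K \<and> 0 \<notin> K \<longrightarrow> emeasure M K < \<infinity>) \<and>
     (\<forall>A\<in>sets borel. 0 \<notin> A \<longrightarrow>
        emeasure M A = (SUP K\<in>{K. compact K \<and> K \<subseteq> A}. emeasure M K) \<and>
        emeasure M A = (INF U\<in>{U. open U \<and> A \<subseteq> U \<and> 0 \<notin> U}. emeasure M U))"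

text \<open>
  Functions on the closure of \<open>\<Omega>\<close> are represented by total functions whose values
  elsewhere are arbitrary. The integral is therefore restricted to those \<open>z\<close> with
  \<open>y + z\<close> in the closure, which under \<open>M0\<close> is a set of full measure for \<open>\<nu> y\<close>.
\<close>

abbreviation jump_set :: "'a::euclidean_space set \<Rightarrow> 'a set \<Rightarrow> 'a \<Rightarrow> 'a set" where
  "jump_set \<Omega> D y \<equiv> {z \<in> D. y + z \<in> closure \<Omega>}"

definition nonlocal ::
    "'a::euclidean_space set \<Rightarrow> ('a \<Rightarrow> 'a measure) \<Rightarrow> 'a set \<Rightarrow> ('a \<Rightarrow> real) \<Rightarrow> 'a \<Rightarrow> real" where
  "nonlocal \<Omega> \<nu> D u y = (LINT z : jump_set \<Omega> D y | \<nu> y. u (y + z) - u y)"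

definition nonlocal_well_defined ::
    "'a::euclidean_space set \<Rightarrow> ('a \<Rightarrow> 'a measure) \<Rightarrow> 'a set \<Rightarrow> ('a \<Rightarrow> real) \<Rightarrow> 'a \<Rightarrow> bool" where
  "nonlocal_well_defined \<Omega> \<nu> D u y \<longleftrightarrow>
     set_integrable (\<nu> y) (jump_set \<Omega> D y) (\<lambda>z. u (y + z) - u y)"

text \<open>
  The measures may be singular, so bounded functions are taken pointwise (bounded and
  Borel measurable) rather than as Lebesgue classes; \<open>D\<close> ranges over Borel sets.
\<close>

definition M0 :: "'a::euclidean_space set \<Rightarrow> ('a \<Rightarrow> 'a measure) \<Rightarrow> bool" where
  "M0 \<Omega> \<nu> \<longleftrightarrow>
     (\<Union>x\<in>closure \<Omega>. (\<lambda>z. x + z) ` measure_supp (\<nu> x)) \<subseteq> closure \<Omega> \<and>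
     (\<forall>x\<in>closure \<Omega>. \<forall>r>0. \<forall>u.
        u \<in> borel_measurable (restrict_space borel (closure \<Omega>)) \<and>
        bounded (u ` closure \<Omega>) \<and>
        C1_on (ball x r \<inter> closure \<Omega>) u \<longrightarrow>
          nonlocal_well_defined \<Omega> \<nu> UNIV u x \<and>
          (\<forall>D\<in>sets borel.
             continuous_on (ball x r \<inter> closure \<Omega>) (nonlocal \<Omega> \<nu> D u)))"

definition h_fun :: "real \<Rightarrow> real \<Rightarrow> real \<Rightarrow> real" where
  "h_fun \<beta> \<sigma> \<delta> =
     (if \<beta> < \<sigma> then \<delta> powr (\<beta> - \<sigma>)
      else if \<beta> = \<sigma> then \<bar>ln \<delta>\<bar> + 1
      else 1)"

definition M1 :: "'a::euclidean_space set \<Rightarrow> ('a \<Rightarrow> 'a measure) \<Rightarrow> real \<Rightarrow> real \<Rightarrow> bool" where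
  "M1 \<Omega> \<nu> \<sigma> C\<^sub>1 \<longleftrightarrow>
     (\<forall>\<beta>\<in>{0..2}. \<forall>\<delta>>0.
        (SUP x\<in>closure \<Omega>. \<integral>\<^sup>+ z\<in>- ball 0 \<delta>. ennreal (min 1 (norm z powr \<beta>)) \<partial>\<nu> x)
          \<le> ennreal (C\<^sub>1 * h_fun \<beta> \<sigma> \<delta>))"

definition M2 :: "'a::euclidean_space set \<Rightarrow> ('a \<Rightarrow> 'a measure) \<Rightarrow> real \<Rightarrow> real \<Rightarrow> bool" where
  "M2 \<Omega> \<nu> \<sigma> C\<^sub>2 \<longleftrightarrow>
     (\<forall>\<beta>\<in>{\<sigma><..2}. \<forall>\<delta>\<in>{0<..<1}.
        (SUP x\<in>closure \<Omega>. \<integral>\<^sup>+ z\<in>ball 0 \<delta>. ennreal (norm z powr \<beta>) \<partial>\<nu> x)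
          \<le> ennreal (C\<^sub>2 * \<delta> powr (\<beta> - \<sigma>)))"

definition viscosity_subsolution ::
    "'a::euclidean_space set \<Rightarrow> ('a \<Rightarrow> 'a measure) \<Rightarrow> real \<Rightarrow> real \<Rightarrow> real \<Rightarrow> ('a \<Rightarrow> real) \<Rightarrow> bool" where
  "viscosity_subsolution \<Omega> \<nu> m b\<^sub>0 A\<^sub>0 u \<longleftrightarrow>
     usc_on (closure \<Omega>) u \<and>
     (\<forall>\<phi> x\<^sub>0 p.
        C1_on (closure \<Omega>) \<phi> \<and> x\<^sub>0 \<in> \<Omega> \<and> GDERIV \<phi> x\<^sub>0 :> p \<and>
        (\<forall>y\<in>closure \<Omega>. u y - \<phi> y \<le> u x\<^sub>0 - \<phi> x\<^sub>0) \<longrightarrow>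
        (\<forall>\<delta>>0. - nonlocal \<Omega> \<nu> (ball 0 \<delta>) \<phi> x\<^sub>0 - nonlocal \<Omega> \<nu> (- ball 0 \<delta>) u x\<^sub>0
                + b\<^sub>0 * norm p powr m \<le> A\<^sub>0))"

text \<open>
  The limit superior is taken in the extended reals; it is finite at boundary points
  of \<open>\<Omega>\<close> when \<open>u\<close> is bounded.
\<close>

definition boundary_limsup :: "'a::euclidean_space set \<Rightarrow> ('a \<Rightarrow> real) \<Rightarrow> 'a \<Rightarrow> real" where
  "boundary_limsup \<Omega> u x =
     (if x \<in> \<Omega> then u x
      else real_of_ereal (Limsup (at x within \<Omega>) (\<lambda>y. ereal (u y))))"

end

theory Submission
  imports Defs
begin

text \<open>
  Let \<open>M\<close> be the oscillation of \<open>u\<close> in \<open>\<Omega>\<close>. In a ball of radius \<open>r \<le> 1\<close> inside \<open>\<Omega>\<close>, a radial test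
  function of slope at least \<open>L\<close> touching \<open>u\<close> from above away from the centre gives
  \<open>c * L powr m \<le> A\<^sub>0 + C * (L + M * r powr (- \<sigma>))\<close>. As \<open>m > 1\<close>, this is impossible for
  \<open>L = \<Lambda> * (1 + M) powr (1 / m) * r powr (- \<sigma> / m)\<close> with \<open>\<Lambda>\<close> large. So in the concentric ball of
  radius \<open>r / 8\<close> the function \<open>u\<close> differs from its value at the centre by at most
  \<open>C * (1 + M) powr (1 / m) * r powr a\<close>, \<open>a = 1 - \<sigma> / m > 0\<close>. Because \<open>a > 0\<close>, these bounds sum to a
  convergent geometric series along a chain of balls shrinking towards the boundary in an interior
  cone, which a \<open>C\<^sup>1\<close> boundary provides. By compactness and connectedness
  \<open>M \<le> C * (1 + M) powr (1 / m)\<close>, which bounds \<open>M\<close>. The values of \<open>u\<close> on the boundary play no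
  role, as \<open>M0\<close> prevents the measures from charging it.
\<close>

section \<open>Domains with \<open>C\<^sup>1\<close> boundary\<close>

text \<open>Inside the ball, the points strictly below the graph form an open set that misses
  \<open>\<Omega>\<close>, so none of them lies in its closure. The points strictly above belong to
  the open set \<open>\<Omega>\<close>, so none of them lies on the frontier. Only the graph is
  left.\<close>

lemma C1_boundary_graphE:
  assumes "open \<Omega>" "C1_boundary \<Omega>" "b \<in> frontier \<Omega>"
  obtains r e \<gamma> where "r > 0" "norm e = 1" "C1_on UNIV \<gamma>"
    "\<Omega> \<inter> ball b r = {y \<in> ball b r. \<gamma> (y - (y \<bullet> e) *\<^sub>R e) < y \<bullet> e}"
    "frontier \<Omega> \<inter> ball b r \<subseteq> {y. \<gamma> (y - (y \<bullet> e) *\<^sub>R e) = y \<bullet> e}"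
proof -
  obtain r e \<gamma> where r: "r > 0" "norm e = 1" "C1_on UNIV \<gamma>" and
    eq: "\<Omega> \<inter> ball b r = {y \<in> ball b r. \<gamma> (y - (y \<bullet> e) *\<^sub>R e) < y \<bullet> e}"
    using bspec[OF assms(2)[unfolded C1_boundary_def] assms(3)] by blast
  have mem: "y \<in> \<Omega> \<longleftrightarrow> \<gamma> (y - (y \<bullet> e) *\<^sub>R e) < y \<bullet> e" if "y \<in> ball b r" for y
  proof -
    have "y \<in> \<Omega> \<inter> ball b r \<longleftrightarrow> y \<in> {y \<in> ball b r. \<gamma> (y - (y \<bullet> e) *\<^sub>R e) < y \<bullet> e}"
      by (simp only: eq)
    then show ?thesis using that by simp
  qed
  have "continuous_on UNIV \<gamma>"
    using r(3) unfolding C1_on_def by (meson UNIV_I has_derivative_continuous_on)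
  then have cont: "continuous_on UNIV (\<lambda>y. \<gamma> (y - (y \<bullet> e) *\<^sub>R e))"
    by (rule continuous_on_compose2) (auto intro!: continuous_intros)
  have "\<gamma> (y - (y \<bullet> e) *\<^sub>R e) = y \<bullet> e" if y: "y \<in> frontier \<Omega>" "y \<in> ball b r" for y
  proof (rule antisym)
    let ?U = "ball b r \<inter> {y. y \<bullet> e < \<gamma> (y - (y \<bullet> e) *\<^sub>R e)}"
    show "\<gamma> (y - (y \<bullet> e) *\<^sub>R e) \<le> y \<bullet> e"
    proof (rule ccontr)
      assume "\<not> \<gamma> (y - (y \<bullet> e) *\<^sub>R e) \<le> y \<bullet> e"
      then have "y \<in> ?U" using y by auto
      moreover have "open ?U"
        by (intro open_Int open_ball open_Collect_less cont continuous_intros)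
      moreover have "?U \<inter> \<Omega> = {}" using mem by force
      moreover have "y \<in> closure \<Omega>" using y(1) by (simp add: frontier_def)
      ultimately show False using open_Int_closure_eq_empty[of ?U \<Omega>] by blast
    qed
    have "y \<notin> \<Omega>" using y(1) \<open>open \<Omega>\<close> by (simp add: frontier_def interior_open)
    then show "y \<bullet> e \<le> \<gamma> (y - (y \<bullet> e) *\<^sub>R e)" using mem[OF y(2)] by simp
  qed
  then have "frontier \<Omega> \<inter> ball b r \<subseteq> {y. \<gamma> (y - (y \<bullet> e) *\<^sub>R e) = y \<bullet> e}" by auto
  then show ?thesis by (rule that[OF r eq])
qed

text \<open>Negligibility is a local property, and near each of its points the frontier lies in the
  image of a hyperplane under the differentiable map \<open>z + \<gamma> z *\<^sub>R e\<close>; such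
  maps send null sets to null sets.\<close>

lemma negligible_frontier_C1_boundary:
  fixes \<Omega> :: "'a::euclidean_space set"
  assumes "open \<Omega>" "C1_boundary \<Omega>"
  shows "negligible (frontier \<Omega>)"
proof (rule locally_negligible_alt[THEN iffD2], rule ballI)
  fix b assume b: "b \<in> frontier \<Omega>"
  obtain r e \<gamma> where r: "r > 0" "norm e = 1" "C1_on UNIV \<gamma>"
    "\<Omega> \<inter> ball b r = {y \<in> ball b r. \<gamma> (y - (y \<bullet> e) *\<^sub>R e) < y \<bullet> e}" and
    sub: "frontier \<Omega> \<inter> ball b r \<subseteq> {y. \<gamma> (y - (y \<bullet> e) *\<^sub>R e) = y \<bullet> e}"
    by (rule C1_boundary_graphE[OF assms b])
  let ?P = "{x. e \<bullet> x = 0}"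
  have ee: "e \<bullet> e = 1" using r(2) by (simp add: norm_eq_1)
  have "negligible ((\<lambda>z. z + \<gamma> z *\<^sub>R e) ` ?P)"
  proof (rule negligible_differentiable_image_negligible)
    have "e \<noteq> 0" using r(2) by auto
    then show "negligible ?P" using negligible_hyperplane by blast
    have "\<gamma> differentiable_on ?P"
      using r(3) unfolding C1_on_def differentiable_on_def differentiable_def
      by (meson UNIV_I has_derivative_at_withinI)
    then show "(\<lambda>z. z + \<gamma> z *\<^sub>R e) differentiable_on ?P"
      unfolding differentiable_on_def by (auto intro!: derivative_intros)
  qed simp
  moreover have "frontier \<Omega> \<inter> ball b r \<subseteq> (\<lambda>z. z + \<gamma> z *\<^sub>R e) ` ?P"
  proof
    fix y assume "y \<in> frontier \<Omega> \<inter> ball b r"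
    then have "y = (y - (y \<bullet> e) *\<^sub>R e) + \<gamma> (y - (y \<bullet> e) *\<^sub>R e) *\<^sub>R e" using sub by auto
    moreover have "y - (y \<bullet> e) *\<^sub>R e \<in> ?P" by (simp add: inner_diff_right ee inner_commute)
    ultimately show "y \<in> (\<lambda>z. z + \<gamma> z *\<^sub>R e) ` ?P" by blast
  qed
  ultimately show "\<exists>U. openin (top_of_set (frontier \<Omega>)) U \<and> b \<in> U \<and> negligible U"
    using b r(1)
    by (intro exI[of _ "frontier \<Omega> \<inter> ball b r"])
      (auto intro: negligible_subset simp: openin_open_Int)
qed

section \<open>Chains of balls\<close>

text \<open>\<open>K\<close> is a separate factor because all consequences are to be linear in it,
  with coefficients independent of \<open>v\<close>. The radius \<open>r / 8\<close> leaves room to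
  exchange \<open>x\<close> and \<open>y\<close>: \<open>ball y (r / 2)\<close> still lies in
  \<open>ball x r\<close>, and \<open>x\<close> is within a quarter of that smaller radius of
  \<open>y\<close>.\<close>

definition interior_holder :: "'a::real_normed_vector set \<Rightarrow> real \<Rightarrow> real \<Rightarrow> ('a \<Rightarrow> real) \<Rightarrow> bool" where
  "interior_holder \<Omega> a K v \<longleftrightarrow>
     (\<forall>x r y. 0 < r \<longrightarrow> r \<le> 1 \<longrightarrow> ball x r \<subseteq> \<Omega> \<longrightarrow> dist x y \<le> r / 8 \<longrightarrow>
        \<bar>v x - v y\<bar> \<le> K * r powr a)"

lemma interior_holderD:
  assumes "interior_holder \<Omega> a K v" "0 < r" "r \<le> 1" "ball x r \<subseteq> \<Omega>" "dist x y \<le> r / 8"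
  shows "\<bar>v x - v y\<bar> \<le> K * r powr a"
  using assms unfolding interior_holder_def by blast

lemma interior_holder_le:
  assumes "interior_holder \<Omega> a K v" "0 < r" "r \<le> 1" "ball x r \<subseteq> \<Omega>" "dist x y \<le> r / 8"
    "0 < a" "0 \<le> K"
  shows "\<bar>v x - v y\<bar> \<le> K"
proof -
  have "r powr a \<le> 1" using assms by (intro powr_le1) auto
  then have "K * r powr a \<le> K" using assms(7) mult_left_le by blast
  then show ?thesis using interior_holderD[OF assms(1-5)] by linarith
qed

text \<open>The points \<open>x + (t * l ^ k) *\<^sub>R e\<close> descend to \<open>x\<close> along
  the axis of the cone. With \<open>l = 1 - c / 8\<close>, each step is one eighth of the radius of
  the cone ball it starts from and costs at most \<open>K * q ^ k\<close>,
  \<open>q = l powr a < 1\<close>. The geometric series is bounded however close \<open>x\<close> is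
  to the frontier.\<close>

lemma interior_holder_cone:
  fixes \<Omega> :: "'a::real_normed_vector set"
  assumes v: "interior_holder \<Omega> a K v" "0 \<le> K" "0 < a" and x: "open \<Omega>" "x \<in> \<Omega>"
    and c: "0 < c" "c \<le> 1" and t: "0 < t" "t \<le> 1" and e: "norm e = 1"
    and cone: "\<And>s. 0 < s \<Longrightarrow> s \<le> t \<Longrightarrow> ball (x + s *\<^sub>R e) (c * s) \<subseteq> \<Omega>"
  shows "\<bar>v (x + t *\<^sub>R e) - v x\<bar> \<le> (1 / (1 - (1 - c / 8) powr a) + 1) * K"
proof -
  define l where "l = 1 - c / 8"
  define q where "q = l powr a"
  have l: "0 < l" "l < 1" using c by (auto simp: l_def)
  have q: "0 < q" "q < 1"
    using l v(3) powr_less_mono2[of a l 1] by (auto simp: q_def)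
  define p where "p k = x + (t * l ^ k) *\<^sub>R e" for k
  have tl: "0 < t * l ^ k" "t * l ^ k \<le> t" "t * l ^ k \<le> l ^ k" for k
    using t l power_le_one[of l k] by (auto intro: mult_left_le mult_right_le_one_le mult_left_le_one_le)
  have step: "\<bar>v (p k) - v (p (Suc k))\<bar> \<le> K * q ^ k" for k
  proof -
    let ?r = "c * (t * l ^ k)"
    have r: "0 < ?r" "?r \<le> l ^ k"
      using c tl[of k] order_trans[OF mult_left_le_one_le[of "t * l ^ k" c] tl(3)] by auto
    have "p k - p (Suc k) = (c / 8 * (t * l ^ k)) *\<^sub>R e"
      by (simp add: p_def l_def algebra_simps)
    then have "dist (p k) (p (Suc k)) = ?r / 8"
      using e r(1) by (simp add: dist_norm)
    moreover have "ball (p k) ?r \<subseteq> \<Omega>" unfolding p_def by (rule cone) (use tl in auto)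
    moreover have "l ^ k \<le> 1" using l by (simp add: power_le_one)
    then have "?r \<le> 1" using r(2) by linarith
    ultimately have "\<bar>v (p k) - v (p (Suc k))\<bar> \<le> K * ?r powr a"
      using r(1) by (intro interior_holderD[OF v(1)]) auto
    also have "?r powr a \<le> (l ^ k) powr a"
      using r v(3) by (intro powr_mono2) auto
    also have "(l ^ k) powr a = q ^ k"
      using l by (simp add: q_def powr_power powr_realpow[symmetric] powr_powr mult.commute)
    finally show ?thesis using v(2) by (simp add: mult_left_mono)
  qed
  have sum: "\<bar>v (p 0) - v (p n)\<bar> \<le> K * (\<Sum>k<n. q ^ k)" for n
  proof (induction n)
    case (Suc n)
    then show ?case using step[of n] by (simp add: algebra_simps)
  qed simp
  \<comment> \<open>The ball about \<open>x\<close> may be arbitrarily small, but its radius only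
    affects the number of steps. The last jump, between \<open>p n\<close> and \<open>x\<close>,
    costs one more \<open>K\<close>.\<close>
  obtain R where R: "0 < R" "R \<le> 1" "ball x R \<subseteq> \<Omega>"
  proof -
    obtain R where "R > 0" "ball x R \<subseteq> \<Omega>" using x open_contains_ball by blast
    moreover from this have "ball x (min R 1) \<subseteq> \<Omega>" by auto
    ultimately show ?thesis using that[of "min R 1"] by simp
  qed
  obtain n where n: "l ^ n < R / 8" using real_arch_pow_inv[of "R / 8" l] l R by auto
  have "dist x (p n) = t * l ^ n" using e tl(1)[of n] by (simp add: p_def dist_norm)
  then have "dist x (p n) \<le> R / 8" using n tl(3)[of n] by linarith
  then have "\<bar>v x - v (p n)\<bar> \<le> K" using R v by (intro interior_holder_le[of \<Omega> a K v R]) auto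
  moreover have "(\<Sum>k<n. q ^ k) \<le> 1 / (1 - q)"
    using q by (simp add: sum_gp_strict divide_right_mono)
  then have "K * (\<Sum>k<n. q ^ k) \<le> K * (1 / (1 - q))" using v(2) by (rule mult_left_mono)
  moreover have "p 0 = x + t *\<^sub>R e" by (simp add: p_def)
  ultimately have "\<bar>v (x + t *\<^sub>R e) - v x\<bar> \<le> K * (1 / (1 - q)) + K" using sum[of n] by simp
  then show ?thesis by (simp add: q_def l_def algebra_simps)
qed

section \<open>Uniform interior cones at a \<open>C\<^sup>1\<close> boundary\<close>

lemma C1_on_UNIV_locally_lipschitz:
  assumes "C1_on UNIV f"
  obtains \<rho> L where "0 < \<rho>" "0 \<le> L"
    "\<And>y z. y \<in> ball x \<rho> \<Longrightarrow> z \<in> ball x \<rho> \<Longrightarrow> \<bar>f y - f z\<bar> \<le> L * norm (y - z)"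
proof -
  obtain g where g: "continuous_on UNIV g" and
    d: "\<And>y. (f has_derivative (\<lambda>h. h \<bullet> g y)) (at y)"
    using assms unfolding C1_on_def by auto
  have "isCont g x" using g by (simp add: continuous_on_eq_continuous_at)
  then obtain \<rho> where \<rho>: "0 < \<rho>" "\<And>y. dist y x < \<rho> \<Longrightarrow> dist (g y) (g x) < 1"
    unfolding continuous_at_eps_delta by (meson zero_less_one)
  have "\<bar>f y - f z\<bar> \<le> (norm (g x) + 1) * norm (y - z)" if "y \<in> ball x \<rho>" "z \<in> ball x \<rho>" for y z
  proof -
    have "norm (f y - f z) \<le> (norm (g x) + 1) * norm (y - z)"
    proof (rule differentiable_bound[OF convex_ball])
      show "(f has_derivative (\<lambda>h. h \<bullet> g w)) (at w within ball x \<rho>)" for w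
        using d has_derivative_at_withinI by blast
      show "onorm (\<lambda>h. h \<bullet> g w) \<le> norm (g x) + 1" if "w \<in> ball x \<rho>" for w
      proof (rule onorm_bound)
        have "norm (g w) \<le> norm (g x) + 1"
          using \<rho>(2)[of w] that norm_triangle_sub[of "g w" "g x"]
          by (simp add: dist_norm norm_minus_commute)
        then show "norm (h \<bullet> g w) \<le> (norm (g x) + 1) * norm h" for h
          using Cauchy_Schwarz_ineq2[of h "g w"] mult_right_mono[of "norm (g w)" "norm (g x) + 1" "norm h"]
          by (simp add: mult.commute)
      qed simp
    qed (use that in auto)
    then show ?thesis by simp
  qed
  then show ?thesis using \<rho>(1) by (intro that[of \<rho> "norm (g x) + 1"]) auto
qed

text \<open>Moving from \<open>y\<close> by \<open>\<tau>\<close> in the direction \<open>e\<close>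
  gains height \<open>\<tau>\<close> above the graph. A further displacement \<open>h\<close> loses
  at most \<open>norm h\<close> of height and raises the graph by at most
  \<open>2 * L * norm h\<close>, since \<open>P\<close> at most doubles norms. The aperture
  \<open>c = 1 / (2 * L + 1)\<close> balances gain and loss.\<close>

lemma C1_boundary_cone:
  fixes \<Omega> :: "'a::euclidean_space set"
  assumes "open \<Omega>" "C1_boundary \<Omega>" "b \<in> frontier \<Omega>"
  obtains s e t c where "0 < s" "norm e = 1" "0 < t" "t \<le> 1" "0 < c" "c \<le> 1"
    "\<And>y \<tau>. y \<in> \<Omega> \<inter> ball b s \<Longrightarrow> 0 < \<tau> \<Longrightarrow> \<tau> \<le> t \<Longrightarrow> ball (y + \<tau> *\<^sub>R e) (c * \<tau>) \<subseteq> \<Omega>"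
proof -
  obtain r e \<gamma> where r: "r > 0" "norm e = 1" "C1_on UNIV \<gamma>"
    and eq: "\<Omega> \<inter> ball b r = {y \<in> ball b r. \<gamma> (y - (y \<bullet> e) *\<^sub>R e) < y \<bullet> e}"
    and "frontier \<Omega> \<inter> ball b r \<subseteq> {y. \<gamma> (y - (y \<bullet> e) *\<^sub>R e) = y \<bullet> e}"
    by (rule C1_boundary_graphE[OF assms])
  define P where "P y = y - (y \<bullet> e) *\<^sub>R e" for y
  have mem: "y \<in> \<Omega> \<longleftrightarrow> \<gamma> (P y) < y \<bullet> e" if "y \<in> ball b r" for y
  proof -
    have "y \<in> \<Omega> \<inter> ball b r \<longleftrightarrow> y \<in> {y \<in> ball b r. \<gamma> (P y) < y \<bullet> e}"
      unfolding P_def by (simp only: eq)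
    then show ?thesis using that by simp
  qed
  have ee: "e \<bullet> e = 1" using r(2) by (simp add: norm_eq_1)
  have P_diff: "P y - P z = P (y - z)" for y z
    by (simp add: P_def inner_diff_left algebra_simps)
  have P_e: "P (y + \<tau> *\<^sub>R e) = P y" for y \<tau>
    by (simp add: P_def inner_add_left ee algebra_simps)
  have P_norm: "norm (P y) \<le> 2 * norm y" for y
  proof -
    have "norm (P y) \<le> norm y + norm ((y \<bullet> e) *\<^sub>R e)" unfolding P_def by (rule norm_triangle_ineq4)
    then show ?thesis using Cauchy_Schwarz_ineq2[of y e] r(2) by simp
  qed
  obtain \<rho> L where \<rho>: "0 < \<rho>" "0 \<le> L" and
    lip: "\<And>y z. y \<in> ball (P b) \<rho> \<Longrightarrow> z \<in> ball (P b) \<rho> \<Longrightarrow> \<bar>\<gamma> y - \<gamma> z\<bar> \<le> L * norm (y - z)"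
    using C1_on_UNIV_locally_lipschitz[OF r(3), where x="P b"] by blast
  \<comment> \<open>\<open>P\<close> maps \<open>ball b d\<close> into the ball where
    \<open>\<gamma>\<close> is Lipschitz. The three displacements, of sizes below
    \<open>d / 2\<close>, at most \<open>d / 4\<close> and below \<open>d / 4\<close>, keep
    \<open>w\<close> in \<open>ball b d\<close>.\<close>
  define d where "d = min r (\<rho> / 2)"
  define t where "t = min 1 (d / 4)"
  define c where "c = 1 / (2 * L + 1)"
  have d: "0 < d" "d \<le> r" "d \<le> \<rho> / 2" using r(1) \<rho>(1) by (auto simp: d_def)
  have t: "0 < t" "t \<le> 1" "t \<le> d / 4" using d by (auto simp: t_def)
  have c: "0 < c" "c \<le> 1" "(2 * L + 1) * c = 1" using \<rho>(2) by (auto simp: c_def field_simps)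
  have Pb: "P y \<in> ball (P b) \<rho>" if "y \<in> ball b d" for y
    using P_norm[of "b - y"] that d(3) by (simp add: dist_norm P_diff)
  show ?thesis
  proof (rule that[of "d / 2" e t c])
    fix y \<tau> assume y: "y \<in> \<Omega> \<inter> ball b (d / 2)" and \<tau>: "0 < \<tau>" "\<tau> \<le> t"
    show "ball (y + \<tau> *\<^sub>R e) (c * \<tau>) \<subseteq> \<Omega>"
    proof
      fix w assume w: "w \<in> ball (y + \<tau> *\<^sub>R e) (c * \<tau>)"
      define h where "h = w - (y + \<tau> *\<^sub>R e)"
      have h: "norm h < c * \<tau>" using w by (simp add: h_def dist_norm norm_minus_commute)
      have "c * \<tau> \<le> \<tau>" using c \<tau> by (simp add: mult_left_le_one_le)
      then have h': "norm h < d / 4" using h \<tau> t by linarith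
      have "w - b = (y - b) + \<tau> *\<^sub>R e + h" by (simp add: h_def)
      then have "norm (w - b) \<le> norm (y - b) + norm (\<tau> *\<^sub>R e) + norm h"
        by (metis norm_triangle_le add_right_mono norm_triangle_ineq)
      also have "\<dots> < d" using y h' \<tau> t r(2) by (simp add: dist_norm norm_minus_commute)
      finally have wb: "w \<in> ball b d" by (simp add: dist_norm norm_minus_commute)
      have yb: "y \<in> ball b d" using y d by simp
      have "P w - P y = P h"
        using P_diff[of w "y + \<tau> *\<^sub>R e"] by (simp add: P_e h_def)
      then have "\<bar>\<gamma> (P w) - \<gamma> (P y)\<bar> \<le> L * norm (P h)"
        using lip[OF Pb[OF wb] Pb[OF yb]] by simp
      also have "\<dots> \<le> L * (2 * norm h)" using P_norm \<rho>(2) by (intro mult_left_mono) auto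
      finally have 1: "\<gamma> (P w) \<le> \<gamma> (P y) + 2 * L * norm h" by simp
      have 2: "\<gamma> (P y) < y \<bullet> e" using mem y d by auto
      have 3: "w \<bullet> e = y \<bullet> e + \<tau> + h \<bullet> e" by (simp add: h_def inner_diff_left inner_add_left ee)
      have 4: "- norm h \<le> h \<bullet> e" using Cauchy_Schwarz_ineq2[of h e] r(2) by simp
      have "(2 * L + 1) * norm h \<le> (2 * L + 1) * (c * \<tau>)"
        using h \<rho>(2) by (intro mult_left_mono) auto
      also have "\<dots> = \<tau>" using c(3) by (simp add: mult.assoc[symmetric])
      finally have "2 * L * norm h + norm h \<le> \<tau>" by (simp add: algebra_simps)
      then have "\<gamma> (P w) < w \<bullet> e" using 1 2 3 4 by linarith
      then show "w \<in> \<Omega>" using mem[of w] wb d by simp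
    qed
  qed (use d r t c in auto)
qed

section \<open>Linking points by chains, uniformly in the function\<close>

text \<open>The quantifiers over \<open>K\<close> and \<open>v\<close> stand inside the relation, so
  that \<open>G\<close> is found before any subsolution is given.\<close>

definition chain_linked :: "'a::euclidean_space set \<Rightarrow> real \<Rightarrow> real \<Rightarrow> 'a \<Rightarrow> 'a \<Rightarrow> bool" where
  "chain_linked \<Omega> a G x y \<longleftrightarrow>
     (\<forall>K v. 0 \<le> K \<longrightarrow> interior_holder \<Omega> a K v \<longrightarrow> \<bar>v x - v y\<bar> \<le> G * K)"

lemma chain_linkedI:
  assumes "\<And>K v. 0 \<le> K \<Longrightarrow> interior_holder \<Omega> a K v \<Longrightarrow> \<bar>v x - v y\<bar> \<le> G * K"
  shows "chain_linked \<Omega> a G x y"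
  using assms unfolding chain_linked_def by blast

lemma chain_linked_sym: "chain_linked \<Omega> a G x y \<Longrightarrow> chain_linked \<Omega> a G y x"
  unfolding chain_linked_def by (simp add: abs_minus_commute)

lemma chain_linked_trans:
  assumes "chain_linked \<Omega> a G x y" "chain_linked \<Omega> a H y z"
  shows "chain_linked \<Omega> a (G + H) x z"
proof (rule chain_linkedI)
  fix K v assume "0 \<le> K" "interior_holder \<Omega> a K v"
  then have "\<bar>v x - v y\<bar> \<le> G * K" "\<bar>v y - v z\<bar> \<le> H * K"
    using assms unfolding chain_linked_def by blast+
  then show "\<bar>v x - v z\<bar> \<le> (G + H) * K" by (simp add: algebra_simps)
qed

lemma chain_linked_mono:
  assumes "chain_linked \<Omega> a G x y" "G \<le> H"
  shows "chain_linked \<Omega> a H x y"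
proof (rule chain_linkedI)
  fix K v assume "0 \<le> K" "interior_holder \<Omega> a K v"
  then show "\<bar>v x - v y\<bar> \<le> H * K"
    using assms unfolding chain_linked_def by (meson mult_right_mono order_trans)
qed

lemma chain_linked_near:
  assumes "0 < r" "r \<le> 1" "ball x r \<subseteq> \<Omega>" "dist x y \<le> r / 8" "0 < a"
  shows "chain_linked \<Omega> a 1 x y"
  using interior_holder_le assms by (intro chain_linkedI) auto

lemma chain_linked_nhd:
  assumes "open \<Omega>" "x \<in> \<Omega>" "0 < a"
  obtains s where "0 < s" "\<And>y. y \<in> ball x s \<Longrightarrow> y \<in> \<Omega> \<and> chain_linked \<Omega> a 1 x y"
proof -
  obtain r where r: "r > 0" "ball x r \<subseteq> \<Omega>" using assms open_contains_ball by blast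
  show ?thesis
  proof (rule that[of "min r 1 / 8"])
    fix y assume y: "y \<in> ball x (min r 1 / 8)"
    then have "y \<in> ball x r" using r(1) by auto
    then show "y \<in> \<Omega> \<and> chain_linked \<Omega> a 1 x y"
      using y r assms(3) by (auto intro!: chain_linked_near[of "min r 1"])
  qed (use r in auto)
qed

text \<open>Being linked by some constant is an equivalence relation, and each point is linked to a
  whole neighbourhood, so a connected set has one class. The constant still depends on the two
  points.\<close>

lemma chain_linked_connected:
  assumes "open \<Omega>" "connected \<Omega>" "x \<in> \<Omega>" "y \<in> \<Omega>" "0 < a"
  shows "\<exists>G. chain_linked \<Omega> a G x y"
proof (rule connected_equivalence_relation[OF assms(2-4), where R="\<lambda>x y. \<exists>G. chain_linked \<Omega> a G x y"])
  fix z assume z: "z \<in> \<Omega>"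
  obtain s where s: "0 < s" "\<And>y. y \<in> ball z s \<Longrightarrow> y \<in> \<Omega> \<and> chain_linked \<Omega> a 1 z y"
    using chain_linked_nhd[OF assms(1) z assms(5)] by blast
  then have "ball z s \<subseteq> \<Omega>" by blast
  then have "openin (top_of_set \<Omega>) (ball z s)" by (simp add: open_subset)
  moreover have "\<forall>x\<in>ball z s. \<exists>G. chain_linked \<Omega> a G z x" using s(2) by blast
  ultimately show "\<exists>T. openin (top_of_set \<Omega>) T \<and> z \<in> T \<and> (\<forall>x\<in>T. \<exists>G. chain_linked \<Omega> a G z x)"
    using s(1) by (intro exI[of _ "ball z s"]) simp
qed (use chain_linked_sym chain_linked_trans in blast)+

text \<open>Each \<open>x\<close> near \<open>b\<close> is linked to
  \<open>x + t *\<^sub>R e\<close> by its cone, at a cost that does not depend on \<open>x\<close>.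
  These upper end points are so close together that one more ball links them to a fixed one.\<close>

lemma chain_linked_boundary_nhd:
  fixes \<Omega> :: "'a::euclidean_space set"
  assumes "open \<Omega>" "C1_boundary \<Omega>" "b \<in> frontier \<Omega>" "0 < a"
  obtains s G q where "0 < s" "q \<in> \<Omega>" "\<And>x. x \<in> \<Omega> \<inter> ball b s \<Longrightarrow> chain_linked \<Omega> a G x q"
proof -
  obtain s e t c where s: "0 < s" "norm e = 1" "0 < t" "t \<le> 1" "0 < c" "c \<le> 1" and
    cone: "\<And>y \<tau>. y \<in> \<Omega> \<inter> ball b s \<Longrightarrow> 0 < \<tau> \<Longrightarrow> \<tau> \<le> t \<Longrightarrow> ball (y + \<tau> *\<^sub>R e) (c * \<tau>) \<subseteq> \<Omega>"
    by (rule C1_boundary_cone[OF assms(1-3)]; rule that; blast)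
  \<comment> \<open>Two points of \<open>ball b s'\<close> are less than \<open>c * t / 8\<close>
    apart, an eighth of the radius of the cone ball at height \<open>t\<close>.\<close>
  define s' where "s' = min s (c * t / 16)"
  have s': "0 < s'" "s' \<le> s" "s' \<le> c * t / 16" using s by (auto simp: s'_def)
  have "b \<in> closure \<Omega>" using assms(3) by (simp add: frontier_def)
  then obtain y where y: "y \<in> \<Omega>" "dist y b < s'"
    using s'(1) by (auto simp: closure_approachable)
  have ct: "0 < c * t" "c * t \<le> 1" using s by (auto intro: mult_le_one)
  let ?G = "1 / (1 - (1 - c / 8) powr a) + 1"
  show ?thesis
  proof (rule that[of s' "y + t *\<^sub>R e" "?G + 1"])
    have "ball (y + t *\<^sub>R e) (c * t) \<subseteq> \<Omega>"
      using y s'(2) s by (intro cone) (auto simp: dist_commute)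
    then show "y + t *\<^sub>R e \<in> \<Omega>" using ct by (meson centre_in_ball subsetD)
    fix x assume x: "x \<in> \<Omega> \<inter> ball b s'"
    have "x \<in> \<Omega> \<inter> ball b s" using x s'(2) by auto
    note cone_x = cone[OF this]
    have "chain_linked \<Omega> a ?G (x + t *\<^sub>R e) x"
      by (rule chain_linkedI, rule interior_holder_cone) (use x s assms cone_x in auto)
    moreover have "chain_linked \<Omega> a 1 (x + t *\<^sub>R e) (y + t *\<^sub>R e)"
    proof (rule chain_linked_near)
      show "ball (x + t *\<^sub>R e) (c * t) \<subseteq> \<Omega>" using x s'(2) s by (intro cone) auto
      have "dist x y < 2 * s'"
        using x y(2) dist_triangle[of x y b] by (simp add: dist_commute)
      then show "dist (x + t *\<^sub>R e) (y + t *\<^sub>R e) \<le> c * t / 8" using s'(3) by simp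
    qed (use ct assms in auto)
    ultimately show "chain_linked \<Omega> a (?G + 1) x (y + t *\<^sub>R e)"
      using chain_linked_sym chain_linked_trans by blast
  qed (use s' in auto)
qed

text \<open>Every point of the compact closure has a neighbourhood whose points in
  \<open>\<Omega>\<close> are linked to the base point \<open>q\<^sub>0\<close> with one constant.
  Finitely many of these neighbourhoods cover, and the sum of the absolute values of their constants
  serves for all.\<close>

proposition interior_holder_osc_bound:
  fixes \<Omega> :: "'a::euclidean_space set"
  assumes "bounded \<Omega>" "open \<Omega>" "connected \<Omega>" "C1_boundary \<Omega>" "0 < a"
  obtains G where "0 \<le> G" "\<And>K v x y. 0 \<le> K \<Longrightarrow> interior_holder \<Omega> a K v \<Longrightarrow> x \<in> \<Omega> \<Longrightarrow> y \<in> \<Omega> \<Longrightarrow>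
    \<bar>v x - v y\<bar> \<le> G * K"
proof (cases "\<Omega> = {}")
  case True
  then show ?thesis using that[of 0] by auto
next
  case False
  then obtain q\<^sub>0 where q0: "q\<^sub>0 \<in> \<Omega>" by blast
  have loc: "\<exists>s G. 0 < s \<and> (\<forall>x\<in>\<Omega> \<inter> ball b s. chain_linked \<Omega> a G x q\<^sub>0)" if b: "b \<in> closure \<Omega>" for b
  proof -
    obtain s G q where s: "0 < s" "q \<in> \<Omega>" "\<And>x. x \<in> \<Omega> \<inter> ball b s \<Longrightarrow> chain_linked \<Omega> a G x q"
    proof (cases "b \<in> \<Omega>")
      case True
      obtain s where "0 < s" "\<And>y. y \<in> ball b s \<Longrightarrow> y \<in> \<Omega> \<and> chain_linked \<Omega> a 1 b y"
        using chain_linked_nhd[OF assms(2) True assms(5)] by blast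
      then show ?thesis using True by (intro that[of s b 1]) (auto intro: chain_linked_sym)
    next
      case False
      then have "b \<in> frontier \<Omega>" using b assms(2) by (simp add: frontier_def interior_open)
      then show ?thesis using chain_linked_boundary_nhd[OF assms(2,4) _ assms(5)] that by blast
    qed
    obtain H where "chain_linked \<Omega> a H q q\<^sub>0"
      using chain_linked_connected[OF assms(2,3) s(2) q0 assms(5)] by blast
    then show ?thesis using s chain_linked_trans by blast
  qed
  then obtain s G where sG: "\<And>b. b \<in> closure \<Omega> \<Longrightarrow> 0 < s b"
    "\<And>b x. b \<in> closure \<Omega> \<Longrightarrow> x \<in> \<Omega> \<inter> ball b (s b) \<Longrightarrow> chain_linked \<Omega> a (G b) x q\<^sub>0"
    by metis
  have "compact (closure \<Omega>)" using assms(1) by (simp add: compact_closure)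
  then obtain T where T: "T \<subseteq> closure \<Omega>" "finite T" "closure \<Omega> \<subseteq> (\<Union>b\<in>T. ball b (s b))"
    by (rule compactE_image[of _ "closure \<Omega>" "\<lambda>b. ball b (s b)"]) (use sG(1) in auto)
  define H where "H = (\<Sum>b\<in>T. \<bar>G b\<bar>)"
  have H: "chain_linked \<Omega> a H x q\<^sub>0" if x: "x \<in> \<Omega>" for x
  proof -
    obtain b where b: "b \<in> T" "x \<in> ball b (s b)" using x T(3) closure_subset by blast
    have "\<bar>G b\<bar> \<le> H" unfolding H_def using b T by (intro member_le_sum) auto
    then have "G b \<le> H" by linarith
    then show ?thesis using chain_linked_mono sG(2) b T(1) x by blast
  qed
  show ?thesis
  proof (rule that[of "H + H"])
    show "0 \<le> H + H" by (simp add: H_def sum_nonneg)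
    fix K :: real and v x y assume *: "0 \<le> K" "interior_holder \<Omega> a K v" "x \<in> \<Omega>" "y \<in> \<Omega>"
    have "chain_linked \<Omega> a (H + H) x y"
      using chain_linked_trans[OF H[OF *(3)] chain_linked_sym[OF H[OF *(4)]]] .
    then show "\<bar>v x - v y\<bar> \<le> (H + H) * K" using * unfolding chain_linked_def by blast
  qed
qed

section \<open>The jump measures do not charge the boundary\<close>

lemma M1_D:
  assumes "M1 \<Omega> \<nu> \<sigma> C\<^sub>1" "sets (\<nu> x) = sets borel" "0 < \<sigma>" "x \<in> closure \<Omega>" "\<delta> > 0"
  shows "emeasure (\<nu> x) (- ball 0 \<delta>) \<le> ennreal (C\<^sub>1 * \<delta> powr (- \<sigma>))"
proof -
  have "emeasure (\<nu> x) (- ball 0 \<delta>) = (\<integral>\<^sup>+ z. indicator (- ball 0 \<delta>) z \<partial>\<nu> x)"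
    using assms(2) by simp
  \<comment> \<open>The exponent \<open>\<beta> = 0\<close> turns the integral into the mass:
    \<open>0 powr 0\<close> is 0, but the origin is outside \<open>- ball 0 \<delta>\<close>, and
    there the integrand is 1.\<close>
  also have "\<dots> \<le> (\<integral>\<^sup>+ z\<in>- ball 0 \<delta>. ennreal (min 1 (norm z powr 0)) \<partial>\<nu> x)"
    using assms(5) by (intro nn_integral_mono) (auto simp: indicator_def)
  also have "\<dots> \<le> (SUP x\<in>closure \<Omega>. \<integral>\<^sup>+ z\<in>- ball 0 \<delta>. ennreal (min 1 (norm z powr 0)) \<partial>\<nu> x)"
    by (rule SUP_upper) fact
  also have "\<dots> \<le> ennreal (C\<^sub>1 * h_fun 0 \<sigma> \<delta>)"
    using assms(1,5) unfolding M1_def by fastforce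
  also have "h_fun 0 \<sigma> \<delta> = \<delta> powr (- \<sigma>)" using assms(3) by (simp add: h_fun_def)
  finally show ?thesis .
qed

text \<open>The exponent 1 is admissible in \<open>M2\<close> because \<open>\<sigma> < 1\<close>;
  it is the one that matches Lipschitz bounds on test functions.\<close>

lemma M2_D:
  assumes "M2 \<Omega> \<nu> \<sigma> C\<^sub>2" "\<sigma> < 1" "x \<in> closure \<Omega>" "0 < \<delta>" "\<delta> < 1"
  shows "(\<integral>\<^sup>+ z\<in>ball 0 \<delta>. ennreal (norm z) \<partial>\<nu> x) \<le> ennreal (C\<^sub>2 * \<delta> powr (1 - \<sigma>))"
proof -
  have "(\<integral>\<^sup>+ z\<in>ball 0 \<delta>. ennreal (norm z) \<partial>\<nu> x) = (\<integral>\<^sup>+ z\<in>ball 0 \<delta>. ennreal (norm z powr 1) \<partial>\<nu> x)"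
    by simp
  also have "\<dots> \<le> (SUP x\<in>closure \<Omega>. \<integral>\<^sup>+ z\<in>ball 0 \<delta>. ennreal (norm z powr 1) \<partial>\<nu> x)"
    by (rule SUP_upper) fact
  also have "\<dots> \<le> ennreal (C\<^sub>2 * \<delta> powr (1 - \<sigma>))"
  proof -
    have "1 \<in> {\<sigma><..2}" "\<delta> \<in> {0<..<1}" using assms by auto
    then show ?thesis using assms(1) unfolding M2_def by blast
  qed
  finally show ?thesis .
qed

text \<open>By Fubini, the Lebesgue integral over \<open>x\<close> of the mass of
  \<open>S - x\<close> is the \<open>\<mu>\<close>-integral over \<open>z\<close> of the Lebesgue
  measure of \<open>S - z\<close>, which vanishes.\<close>

lemma AE_translate_null:
  fixes \<mu> :: "'a::euclidean_space measure"
  assumes "finite_measure \<mu>" "sets \<mu> = sets borel" "closed S" "negligible S"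
  shows "AE x in lborel. emeasure \<mu> {z. x + z \<in> S} = 0"
proof -
  interpret \<mu>: finite_measure \<mu> by fact
  interpret pair_sigma_finite \<mu> lborel ..
  have S[measurable]: "S \<in> sets borel" using \<open>closed S\<close> by simp
  have S0: "S \<in> null_sets lborel"
    using \<open>negligible S\<close> S by (simp add: negligible_iff_null_sets null_sets_completion_iff)
  have [measurable]: "{z. x + z \<in> S} \<in> sets borel" for x
  proof -
    have "(\<lambda>z. x + z) -` S \<inter> space borel \<in> sets borel" by (rule measurable_sets[of _ borel borel]) auto
    then show ?thesis by (simp add: vimage_def)
  qed
  note [measurable_cong] = \<open>sets \<mu> = sets borel\<close>
  have meas: "(\<lambda>(z, x). indicator S (x + z) :: ennreal) \<in> borel_measurable (\<mu> \<Otimes>\<^sub>M lborel)"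
    by measurable
  have "(\<integral>\<^sup>+ x. emeasure \<mu> {z. x + z \<in> S} \<partial>lborel) = (\<integral>\<^sup>+ x. (\<integral>\<^sup>+ z. indicator S (x + z) \<partial>\<mu>) \<partial>lborel)"
  proof (intro nn_integral_cong)
    fix x :: 'a
    have "emeasure \<mu> {z. x + z \<in> S} = (\<integral>\<^sup>+ z. indicator {z. x + z \<in> S} z \<partial>\<mu>)"
      using assms(2) by (subst nn_integral_indicator) auto
    also have "\<dots> = (\<integral>\<^sup>+ z. indicator S (x + z) \<partial>\<mu>)"
      by (intro nn_integral_cong) (simp add: indicator_def)
    finally show "emeasure \<mu> {z. x + z \<in> S} = (\<integral>\<^sup>+ z. indicator S (x + z) \<partial>\<mu>)" .
  qed
  also have "\<dots> = (\<integral>\<^sup>+ z. (\<integral>\<^sup>+ x. indicator S (x + z) \<partial>lborel) \<partial>\<mu>)"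
    by (rule Fubini'[OF meas])
  also have "\<dots> = (\<integral>\<^sup>+ z. 0 \<partial>\<mu>)"
  proof (intro nn_integral_cong)
    fix z :: 'a
    have "(\<integral>\<^sup>+ x. indicator S (x + z) \<partial>lborel) = (\<integral>\<^sup>+ x. indicator S x \<partial>distr lborel borel ((+) z))"
      by (subst nn_integral_distr) (auto simp: add.commute)
    also have "\<dots> = 0" using S0 by (simp add: lborel_distr_plus null_setsD1)
    finally show "(\<integral>\<^sup>+ x. indicator S (x + z) \<partial>lborel) = (0::ennreal)" .
  qed
  finally have "(\<integral>\<^sup>+ x. emeasure \<mu> {z. x + z \<in> S} \<partial>lborel) = 0" by simp
  moreover have "(\<lambda>x. emeasure \<mu> {z. x + z \<in> S}) \<in> borel_measurable lborel"
  proof -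
    have "{(x, z). x + z \<in> S} \<in> sets (borel \<Otimes>\<^sub>M \<mu>)"
    proof -
      have "(\<lambda>(x, z). x + z) -` S \<inter> space (borel \<Otimes>\<^sub>M \<mu>) \<in> sets (borel \<Otimes>\<^sub>M \<mu>)"
        by (rule measurable_sets[of _ _ borel]) measurable
      moreover have "(\<lambda>(x, z). x + z) -` S \<inter> space (borel \<Otimes>\<^sub>M \<mu>) = {(x, z). x + z \<in> S}"
        using sets_eq_imp_space_eq[OF assms(2)] by (auto simp: space_pair_measure)
      ultimately show ?thesis by simp
    qed
    from \<mu>.measurable_emeasure_Pair[OF this] show ?thesis by (simp add: vimage_def)
  qed
  ultimately show ?thesis by (simp add: nn_integral_0_iff_AE)
qed

lemma nonlocal_indicator_frontier:
  assumes "open \<Omega>" "sets (\<nu> y) = sets borel" "y \<in> \<Omega>" "D \<in> sets borel"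
  shows "nonlocal \<Omega> \<nu> D (indicator (frontier \<Omega>)) y
      = measure (\<nu> y) (D \<inter> {z. y + z \<in> frontier \<Omega>})"
proof -
  have "y \<notin> frontier \<Omega>" using assms(1,3) by (simp add: frontier_def interior_open)
  then have "(\<lambda>z. indicator (jump_set \<Omega> D y) z *\<^sub>R (indicator (frontier \<Omega>) (y + z) - indicator (frontier \<Omega>) y :: real))
      = indicator (D \<inter> {z. y + z \<in> frontier \<Omega>})"
    by (auto simp: indicator_def frontier_def)
  then show ?thesis
    using sets_eq_imp_space_eq[OF assms(2)]
    by (simp add: nonlocal_def set_lebesgue_integral_def)
qed

text \<open>The indicator of the frontier is bounded and Borel and vanishes on every ball inside
  \<open>\<Omega>\<close>. It is therefore an admissible function in \<open>M0\<close>, and at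
  interior points the operator sends it to this mass.\<close>

lemma M0_continuous_on_frontier_mass:
  assumes "open \<Omega>" "\<And>x. x \<in> closure \<Omega> \<Longrightarrow> sets (\<nu> x) = sets borel" "M0 \<Omega> \<nu>" "D \<in> sets borel"
  shows "continuous_on \<Omega> (\<lambda>y. measure (\<nu> y) (D \<inter> {z. y + z \<in> frontier \<Omega>}))"
proof -
  let ?i = "indicator (frontier \<Omega>) :: 'a \<Rightarrow> real"
  have "isCont (nonlocal \<Omega> \<nu> D ?i) x" if x: "x \<in> \<Omega>" for x
  proof -
    obtain r where r: "r > 0" "ball x r \<subseteq> \<Omega>"
      using assms(1) x open_contains_ball by blast
    then have sub: "ball x r \<inter> closure \<Omega> = ball x r" using closure_subset by blast
    have zero: "?i y = 0" if "y \<in> ball x r" for y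
      using that r(2) assms(1) by (auto simp: frontier_def interior_open)
    have "C1_on (ball x r) ?i"
      unfolding C1_on_def
    proof (intro exI conjI ballI)
      show "continuous_on (ball x r) (\<lambda>_. 0 :: 'a)" by simp
      fix y assume y: "y \<in> ball x r"
      have "((\<lambda>_. 0) has_derivative (\<lambda>h. h \<bullet> 0)) (at y within ball x r)" by simp
      then show "(?i has_derivative (\<lambda>h. h \<bullet> 0)) (at y within ball x r)"
        by (rule has_derivative_transform[OF y zero, rotated])
    qed
    moreover have "?i \<in> borel_measurable (restrict_space borel (closure \<Omega>))"
      by (rule measurable_restrict_space1) (intro borel_measurable_indicator, simp)
    moreover have "bounded (?i ` closure \<Omega>)"
      by (rule boundedI[of _ 1]) (auto simp: indicator_def)
    moreover have "x \<in> closure \<Omega>" using x closure_subset by blast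
    ultimately have "continuous_on (ball x r \<inter> closure \<Omega>) (nonlocal \<Omega> \<nu> D ?i)"
      using assms(3)[unfolded M0_def, THEN conjunct2, rule_format, of x r ?i] assms(4) r(1)
      by (simp add: sub)
    then have "continuous_on (ball x r) (nonlocal \<Omega> \<nu> D ?i)" by (simp only: sub)
    then show ?thesis using r(1) by (simp add: continuous_on_eq_continuous_at)
  qed
  then have "continuous_on \<Omega> (nonlocal \<Omega> \<nu> D ?i)"
    by (simp add: continuous_at_imp_continuous_on)
  then show ?thesis
    by (rule continuous_on_eq)
      (use assms closure_subset in \<open>auto intro!: nonlocal_indicator_frontier\<close>)
qed

text \<open>
  \<open>M0\<close> is assumed for every Borel set \<open>D\<close> at once, and this forbids the measures \<open>\<nu> x\<close> to charge
  the null set \<open>frontier \<Omega>\<close>: with \<open>D = frontier \<Omega> - x\<close>, Fubini's theorem shows for almost every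
  \<open>x\<close> that \<open>\<nu> y ((frontier \<Omega> - x) \<inter> (frontier \<Omega> - y)) = 0\<close> for all \<open>y\<close> in a countable dense set,
  so by continuity also at \<open>y = x\<close>.
\<close>

lemma jump_measure_frontier_eq_0:
  fixes \<Omega> :: "'a::euclidean_space set"
  assumes "open \<Omega>" "negligible (frontier \<Omega>)"
    and sets: "\<And>x. x \<in> closure \<Omega> \<Longrightarrow> sets (\<nu> x) = sets borel"
    and "M0 \<Omega> \<nu>" "M1 \<Omega> \<nu> \<sigma> C\<^sub>1" "0 < \<sigma>" "x \<in> \<Omega>"
  shows "emeasure (\<nu> x) {z. x + z \<in> frontier \<Omega>} = 0"
proof -
  let ?F = "\<lambda>x. {z. x + z \<in> frontier \<Omega>}"
  have F: "?F x \<in> sets borel" for x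
  proof -
    have "(\<lambda>z. x + z) -` frontier \<Omega> \<inter> space borel \<in> sets borel"
      by (rule measurable_sets[of _ borel borel]) auto
    then show ?thesis by (simp add: vimage_def)
  qed
  have cl: "y \<in> closure \<Omega>" if "y \<in> \<Omega>" for y using that closure_subset by blast
  \<comment> \<open>A jump from the open set \<open>\<Omega>\<close> to its frontier has length at
    least some \<open>\<delta> > 0\<close>, and \<open>M1\<close> bounds the mass of such
    jumps.\<close>
  have fin: "emeasure (\<nu> y) (?F y) < \<infinity>" if y: "y \<in> \<Omega>" for y
  proof -
    obtain \<delta> where \<delta>: "\<delta> > 0" "ball y \<delta> \<subseteq> \<Omega>"
      using assms(1) y open_contains_ball by blast
    have "z \<notin> ball 0 \<delta>" if "z \<in> ?F y" for z
    proof
      assume "z \<in> ball 0 \<delta>"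
      then have "y + z \<in> \<Omega>" using \<delta>(2) by (auto simp: dist_norm)
      then show False using that assms(1) by (simp add: frontier_def interior_open)
    qed
    then have "emeasure (\<nu> y) (?F y) \<le> emeasure (\<nu> y) (- ball 0 \<delta>)"
      by (intro emeasure_mono) (auto simp: sets cl y)
    also have "\<dots> \<le> ennreal (C\<^sub>1 * \<delta> powr (- \<sigma>))"
      by (rule M1_D[OF assms(5)]) (use sets cl y assms \<delta> in auto)
    finally show ?thesis by (simp add: le_less_trans)
  qed
  obtain Q where Q: "countable Q" "Q \<subseteq> \<Omega>" "\<Omega> \<subseteq> closure Q"
    using separable by blast
  have "AE x in lborel. measure (\<nu> y) (?F x \<inter> ?F y) = 0" if y: "y \<in> Q" for y
  proof -
    \<comment> \<open>Restricting \<open>\<nu> y\<close> to the jumps that reach the frontier gives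
      a finite measure, to which Fubini's theorem applies.\<close>
    let ?\<mu> = "density (\<nu> y) (indicator (?F y))"
    have sy: "sets (\<nu> y) = sets borel" using sets cl Q(2) y by blast
    have em: "emeasure ?\<mu> A = emeasure (\<nu> y) (?F y \<inter> A)" if "A \<in> sets borel" for A
      using that F sy by (subst emeasure_density) 
        (auto simp: indicator_inter_arith[symmetric] intro!: nn_integral_indicator)
    have "finite_measure ?\<mu>"
    proof
      have "emeasure ?\<mu> UNIV = emeasure (\<nu> y) (?F y)" by (subst em) auto
      then show "emeasure ?\<mu> (space ?\<mu>) \<noteq> \<infinity>"
        using fin[of y] Q(2) y sets_eq_imp_space_eq[OF sy] by auto
    qed
    then have "AE x in lborel. emeasure ?\<mu> (?F x) = 0"
      using sy assms(2) by (intro AE_translate_null) auto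
    then show ?thesis
      by eventually_elim (simp add: em[OF F] measure_def Int_commute)
  qed
  then have "AE x in lborel. \<forall>y\<in>Q. measure (\<nu> y) (?F x \<inter> ?F y) = 0"
    using Q(1) by (simp add: AE_ball_countable)
  then have AE0: "AE x in lborel. x \<in> \<Omega> \<longrightarrow> measure (\<nu> x) (?F x) = 0"
  proof eventually_elim
    case (elim x)
    show ?case
    proof
      assume x: "x \<in> \<Omega>"
      have "continuous_on \<Omega> (\<lambda>y. measure (\<nu> y) (?F x \<inter> ?F y))"
        by (rule M0_continuous_on_frontier_mass[OF assms(1) sets assms(4) F])
      then have lim: "((\<lambda>n. measure (\<nu> (q n)) (?F x \<inter> ?F (q n))) \<longlongrightarrow> measure (\<nu> x) (?F x \<inter> ?F x)) sequentially"
        if "q \<longlonglongrightarrow> x" "\<And>n. q n \<in> Q" for q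
        by (rule continuous_on_tendsto_compose[OF _ that(1) x]) (simp_all add: subsetD[OF Q(2)] that(2))
      have "x \<in> closure Q" using x Q(3) by blast
      then obtain q where q: "\<And>n. q n \<in> Q" "q \<longlonglongrightarrow> x"
        using closure_sequential by blast
      then show "measure (\<nu> x) (?F x) = 0"
        using elim lim[OF q(2) q(1)] by (simp add: LIMSEQ_const_iff)
    qed
  qed
  have cont: "continuous_on \<Omega> (\<lambda>y. measure (\<nu> y) (?F y))"
    using M0_continuous_on_frontier_mass[OF assms(1) sets assms(4), of UNIV] by simp
  \<comment> \<open>From almost every point to every point: by continuity of the mass, the
    exceptional set is open, and an open negligible set is empty.\<close>
  let ?N = "\<Omega> \<inter> (\<lambda>y. measure (\<nu> y) (?F y)) -` (- {0})"
  have "open ?N"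
    using assms(1) cont by (intro continuous_open_preimage) auto
  moreover have "negligible ?N"
  proof -
    have "AE x in lebesgue. x \<notin> ?N"
      using AE_completion[OF AE0] by eventually_elim auto
    then show ?thesis
      unfolding eventually_ae_filter_negligible by (auto elim!: negligible_subset)
  qed
  ultimately have "?N = {}" using open_not_negligible by blast
  then have "measure (\<nu> x) (?F x) = 0" using assms(7) by blast
  then show ?thesis
    using fin[OF assms(7)] by (simp add: measure_eq_emeasure_eq_ennreal emeasure_eq_ennreal_measure less_top)
qed

section \<open>Interior estimate for subsolutions\<close>

text \<open>If no maximum exists, each \<open>x\<close> has a better point \<open>f x\<close>, and
  semicontinuity makes \<open>f x\<close> better than all points near \<open>x\<close>. In a finite
  subcover, the best of the values at \<open>f t\<close> is beaten by the one belonging to a ball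
  that contains \<open>f t\<close>.\<close>

lemma usc_diff_attains_max:
  fixes u :: "'a::euclidean_space \<Rightarrow> real"
  assumes "compact S" "S \<noteq> {}" "usc_on S u" "continuous_on S \<phi>"
  obtains x\<^sub>0 where "x\<^sub>0 \<in> S" "\<And>y. y \<in> S \<Longrightarrow> u y - \<phi> y \<le> u x\<^sub>0 - \<phi> x\<^sub>0"
proof (rule ccontr)
  let ?g = "\<lambda>y. u y - \<phi> y"
  assume "\<not> thesis"
  then have "\<forall>x\<in>S. \<exists>y\<in>S. ?g x < ?g y" using that by (meson not_le)
  then obtain f where f: "\<And>x. x \<in> S \<Longrightarrow> f x \<in> S" "\<And>x. x \<in> S \<Longrightarrow> ?g x < ?g (f x)" by metis
  have "\<exists>d>0. \<forall>y\<in>S \<inter> ball x d. ?g y < ?g (f x)" if x: "x \<in> S" for x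
  proof -
    define e where "e = (?g (f x) - ?g x) / 2"
    have e: "0 < e" using f(2)[OF x] by (simp add: e_def)
    have e2: "?g (f x) = ?g x + 2 * e" unfolding e_def by (simp add: field_simps)
    have "\<forall>\<^sub>F y in at x within S. u y < u x + e"
      using assms(3) x e unfolding usc_on_def by simp
    moreover have "(\<phi> \<longlongrightarrow> \<phi> x) (at x within S)"
      using assms(4) x by (simp add: continuous_on_def)
    then have "\<forall>\<^sub>F y in at x within S. \<phi> x - e < \<phi> y"
      using e by (intro order_tendstoD) auto
    ultimately have "\<forall>\<^sub>F y in at x within S. ?g y < ?g (f x)"
      by eventually_elim (use e2 in linarith)
    then obtain d where d: "0 < d" "\<And>y. y \<in> S \<Longrightarrow> y \<noteq> x \<Longrightarrow> dist y x < d \<Longrightarrow> ?g y < ?g (f x)"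
      unfolding eventually_at by blast
    have "?g y < ?g (f x)" if "y \<in> S \<inter> ball x d" for y
      using that d(2)[of y] f(2)[OF x] by (cases "y = x") (auto simp: dist_commute)
    then show ?thesis using d(1) by blast
  qed
  then obtain d where d: "\<And>x. x \<in> S \<Longrightarrow> 0 < d x"
    "\<And>x y. x \<in> S \<Longrightarrow> y \<in> S \<Longrightarrow> y \<in> ball x (d x) \<Longrightarrow> ?g y < ?g (f x)"
    by (metis IntI)
  obtain T where T: "T \<subseteq> S" "finite T" "S \<subseteq> (\<Union>x\<in>T. ball x (d x))"
    by (rule compactE_image[OF assms(1), of S "\<lambda>x. ball x (d x)"]) (use d(1) in auto)
  have "T \<noteq> {}" using T(3) assms(2) by auto
  then have "Max ((\<lambda>x. ?g (f x)) ` T) \<in> (\<lambda>x. ?g (f x)) ` T" using T(2) by (intro Max_in) auto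
  then obtain t where t: "t \<in> T" "Max ((\<lambda>x. ?g (f x)) ` T) = ?g (f t)" by blast
  obtain x where x: "x \<in> T" "f t \<in> ball x (d x)" using f(1) t(1) T by blast
  then have "?g (f t) < ?g (f x)" using d(2) T(1) f(1) t(1) by blast
  moreover have "?g (f x) \<le> Max ((\<lambda>x. ?g (f x)) ` T)" using T(2) x(1) by (intro Max_ge) auto
  ultimately show False using t(2) by linarith
qed

text \<open>
  The arctangent makes the radial test function smooth on the whole space. As \<open>\<kappa>\<close> tends to \<open>0\<close>, its
  rise before \<open>t = r\<close> becomes arbitrarily large, while at a fixed \<open>t < r\<close> the derivative stays below
  \<open>2 * L / (1 - t / r)\<^sup>2\<close>. So the uncontrolled values of \<open>u\<close> on the boundary force \<open>\<kappa>\<close> to be small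
  but do not enter the estimate.
\<close>

definition barrier :: "real \<Rightarrow> real \<Rightarrow> real \<Rightarrow> real \<Rightarrow> real" where
  "barrier \<kappa> r L t = 2 * L * r / \<kappa> * arctan ((t / r - 1) / \<kappa>)"

definition barrier_deriv :: "real \<Rightarrow> real \<Rightarrow> real \<Rightarrow> real \<Rightarrow> real" where
  "barrier_deriv \<kappa> r L t = 2 * L / (\<kappa>\<^sup>2 + (t / r - 1)\<^sup>2)"

lemma barrier_has_derivative:
  assumes "0 < \<kappa>" "0 < r"
  shows "(barrier \<kappa> r L has_real_derivative barrier_deriv \<kappa> r L t) (at t within S)"
proof -
  have pos: "\<kappa>\<^sup>2 + (t / r - 1)\<^sup>2 > 0" using assms(1) by (simp add: add_pos_nonneg)
  have "1 + ((t / r - 1) / \<kappa>)\<^sup>2 = (\<kappa>\<^sup>2 + (t / r - 1)\<^sup>2) / \<kappa>\<^sup>2"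
    using assms(1) by (simp add: power_divide field_simps)
  moreover have "(barrier \<kappa> r L has_real_derivative
      2 * L * r / \<kappa> * (inverse (1 + ((t / r - 1) / \<kappa>)\<^sup>2) * (1 / r / \<kappa>))) (at t within S)"
    unfolding barrier_def[abs_def] using assms by (auto intro!: derivative_eq_intros)
  ultimately show ?thesis
    using assms pos by (simp add: barrier_deriv_def power2_eq_square field_simps)
qed

lemma barrier_mono:
  assumes "0 < \<kappa>" "0 < r" "0 \<le> L" "s \<le> t"
  shows "barrier \<kappa> r L s \<le> barrier \<kappa> r L t"
  unfolding barrier_def using assms
  by (intro mult_left_mono) (auto simp: arctan_le_iff divide_right_mono)

lemma barrier_lipschitz:
  assumes "0 < \<kappa>" "0 < r" "convex S" "s \<in> S" "t \<in> S"
    and "\<And>x. x \<in> S \<Longrightarrow> \<bar>barrier_deriv \<kappa> r L x\<bar> \<le> B"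
  shows "\<bar>barrier \<kappa> r L s - barrier \<kappa> r L t\<bar> \<le> B * \<bar>s - t\<bar>"
  using field_differentiable_bound[OF assms(3) barrier_has_derivative[OF assms(1,2)], of L B s t] assms
  by simp

text \<open>\<open>W\<close> is the Euclidean norm of the pair \<open>\<kappa>\<close>,
  \<open>t / r - 1\<close>. Replacing \<open>t\<close> by \<open>s\<close> moves the pair by at most
  \<open>W / 2\<close>, so its norm stays at least \<open>W / 2\<close>, and the derivative is
  inversely proportional to the square of the norm.\<close>

lemma barrier_deriv_doubling:
  assumes "0 < \<kappa>" "0 < r" "0 \<le> L" "\<bar>s - t\<bar> \<le> r * sqrt (\<kappa>\<^sup>2 + (t / r - 1)\<^sup>2) / 2"
  shows "\<bar>barrier_deriv \<kappa> r L s\<bar> \<le> 4 * barrier_deriv \<kappa> r L t"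
proof -
  define w where "w = t / r - 1"
  define W where "W = sqrt (\<kappa>\<^sup>2 + w\<^sup>2)"
  define e where "e = (s - t) / r"
  have W: "W\<^sup>2 = \<kappa>\<^sup>2 + w\<^sup>2" "0 < W" "\<bar>w\<bar> \<le> W"
    using assms(1) by (auto simp: W_def add_pos_nonneg real_le_rsqrt)
  have e: "\<bar>e\<bar> \<le> W / 2" using assms by (simp add: e_def W_def w_def abs_divide field_simps)
  have "\<bar>w\<bar> * \<bar>e\<bar> \<le> W * \<bar>e\<bar>" using W by (intro mult_right_mono) auto
  then have "w * e \<ge> - (W * \<bar>e\<bar>)" by (simp add: abs_mult[symmetric])
  then have "\<kappa>\<^sup>2 + (w + e)\<^sup>2 \<ge> W\<^sup>2 - 2 * W * \<bar>e\<bar> + \<bar>e\<bar>\<^sup>2"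
    using W(1) by (simp add: power2_eq_square algebra_simps)
  also have "W\<^sup>2 - 2 * W * \<bar>e\<bar> + \<bar>e\<bar>\<^sup>2 = (W - \<bar>e\<bar>)\<^sup>2" by (simp add: power2_eq_square algebra_simps)
  also have "(W - \<bar>e\<bar>)\<^sup>2 \<ge> (W / 2)\<^sup>2" using e W(2) by (intro power_mono) auto
  finally have "W\<^sup>2 / 4 \<le> \<kappa>\<^sup>2 + (w + e)\<^sup>2" by (simp add: power_divide)
  moreover have "s / r - 1 = w + e" using assms(2) by (simp add: w_def e_def field_simps)
  ultimately have *: "W\<^sup>2 / 4 \<le> \<kappa>\<^sup>2 + (s / r - 1)\<^sup>2" by simp
  have "0 < \<kappa>\<^sup>2 + (s / r - 1)\<^sup>2" using assms(1) by (simp add: add_pos_nonneg)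
  then have "2 * L / (\<kappa>\<^sup>2 + (s / r - 1)\<^sup>2) \<le> 2 * L / (W\<^sup>2 / 4)"
    using * W(2) assms(3) by (intro divide_left_mono mult_pos_pos) auto
  moreover have "0 \<le> 2 * L / (\<kappa>\<^sup>2 + (s / r - 1)\<^sup>2)" using assms(3) by simp
  ultimately show ?thesis by (simp add: barrier_deriv_def W(1) w_def)
qed

section \<open>Smoothed distance and radial test functions\<close>

text \<open>The norm of the pair \<open>(s, y - x)\<close>: for \<open>s > 0\<close> it is
  differentiable also at \<open>y = x\<close>, so radial functions of it are
  \<open>C\<^sup>1\<close> everywhere.\<close>

definition soft_dist :: "real \<Rightarrow> 'a::euclidean_space \<Rightarrow> 'a \<Rightarrow> real" where
  "soft_dist s x y = sqrt (s\<^sup>2 + (norm (y - x))\<^sup>2)"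

lemma soft_dist_eq_norm: "soft_dist s x y = norm (s, y - x)"
  by (simp add: soft_dist_def norm_Pair)

lemma soft_dist_pos: "0 < s \<Longrightarrow> 0 < soft_dist s x y"
  by (simp add: soft_dist_def add_pos_nonneg)

lemma soft_dist_ge: "norm (y - x) \<le> soft_dist s x y"
  by (simp add: soft_dist_def real_le_rsqrt)

lemma soft_dist_le: "0 \<le> s \<Longrightarrow> soft_dist s x y \<le> s + norm (y - x)"
  using norm_Pair_le[of s "y - x"] by (simp add: soft_dist_eq_norm)

lemma soft_dist_lipschitz: "\<bar>soft_dist s x y - soft_dist s x z\<bar> \<le> norm (y - z)"
  using norm_triangle_ineq3[of "(s, y - x)" "(s, z - x)"]
  by (simp add: soft_dist_eq_norm norm_Pair)

lemma soft_dist_has_derivative: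
  assumes "0 < s"
  shows "(soft_dist s x has_derivative (\<lambda>h. h \<bullet> ((1 / soft_dist s x y) *\<^sub>R (y - x)))) (at y within S)"
proof -
  have eq: "soft_dist s x = (\<lambda>y. sqrt (s\<^sup>2 + (y - x) \<bullet> (y - x)))"
    by (simp add: soft_dist_def fun_eq_iff power2_norm_eq_inner)
  have pos: "0 < s\<^sup>2 + (y - x) \<bullet> (y - x)" using assms by (simp add: add_pos_nonneg)
  have "((\<lambda>y. s\<^sup>2 + (y - x) \<bullet> (y - x)) has_derivative (\<lambda>h. 2 * (h \<bullet> (y - x)))) (at y within S)"
    by (auto intro!: derivative_eq_intros simp: inner_commute)
  then have "((\<lambda>y. sqrt (s\<^sup>2 + (y - x) \<bullet> (y - x))) has_derivative
      (\<lambda>h. 2 * (h \<bullet> (y - x)) * (inverse (sqrt (s\<^sup>2 + (y - x) \<bullet> (y - x))) / 2))) (at y within S)"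
    by (rule DERIV_compose_FDERIV[where f=sqrt and g="\<lambda>y. s\<^sup>2 + (y - x) \<bullet> (y - x)", OF DERIV_real_sqrt[OF pos]])
  moreover have "(\<lambda>h. 2 * (h \<bullet> (y - x)) * (inverse (sqrt (s\<^sup>2 + (y - x) \<bullet> (y - x))) / 2))
      = (\<lambda>h. h \<bullet> ((1 / soft_dist s x y) *\<^sub>R (y - x)))"
    unfolding fun_cong[OF eq, of y, symmetric] by (rule ext) (simp add: divide_inverse[symmetric])
  ultimately show ?thesis by (simp only: eq)
qed

definition radial_test :: "real \<Rightarrow> real \<Rightarrow> real \<Rightarrow> real \<Rightarrow> 'a::euclidean_space \<Rightarrow> 'a \<Rightarrow> real" where
  "radial_test \<kappa> r L s x y = barrier \<kappa> r L (soft_dist s x y)"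

definition radial_test_grad :: "real \<Rightarrow> real \<Rightarrow> real \<Rightarrow> real \<Rightarrow> 'a::euclidean_space \<Rightarrow> 'a \<Rightarrow> 'a" where
  "radial_test_grad \<kappa> r L s x y = (barrier_deriv \<kappa> r L (soft_dist s x y) / soft_dist s x y) *\<^sub>R (y - x)"

lemma radial_test_has_derivative:
  assumes "0 < \<kappa>" "0 < r" "0 < s"
  shows "(radial_test \<kappa> r L s x has_derivative (\<lambda>h. h \<bullet> radial_test_grad \<kappa> r L s x y)) (at y within S)"
proof -
  have "((\<lambda>y. barrier \<kappa> r L (soft_dist s x y)) has_derivative
      (\<lambda>h. (h \<bullet> ((1 / soft_dist s x y) *\<^sub>R (y - x))) * barrier_deriv \<kappa> r L (soft_dist s x y))) (at y within S)"
    by (rule DERIV_compose_FDERIV[OF barrier_has_derivative soft_dist_has_derivative]) (use assms in auto)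
  then show ?thesis
    by (simp add: radial_test_def[abs_def] radial_test_grad_def mult.commute)
qed

lemma C1_on_radial_test:
  assumes "0 < \<kappa>" "0 < r" "0 < s"
  shows "C1_on S (radial_test \<kappa> r L s x)"
  unfolding C1_on_def
proof (intro exI conjI ballI)
  have [simp]: "\<kappa>\<^sup>2 + c\<^sup>2 \<noteq> 0" for c using assms(1) by (simp add: sum_power2_eq_zero_iff)
  have "continuous_on S (soft_dist s x)"
    unfolding soft_dist_def[abs_def] by (intro continuous_intros)
  then show "continuous_on S (radial_test_grad \<kappa> r L s x)"
    unfolding radial_test_grad_def[abs_def] barrier_deriv_def
    using soft_dist_pos[OF assms(3), of x] assms(1,2)
    by (intro continuous_intros) (auto simp: less_le)
qed (rule radial_test_has_derivative[OF assms])

lemma norm_radial_test_grad_ge: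
  assumes "0 < s" "s \<le> norm (y - x)" "0 \<le> L"
  shows "barrier_deriv \<kappa> r L (soft_dist s x y) / 2 \<le> norm (radial_test_grad \<kappa> r L s x y)"
proof -
  have "soft_dist s x y \<le> 2 * norm (y - x)"
    using soft_dist_le[of s x y] assms by simp
  then have "1 / 2 \<le> norm (y - x) / soft_dist s x y"
    using soft_dist_pos[OF assms(1), of x y] by (simp add: field_simps)
  moreover have b: "0 \<le> barrier_deriv \<kappa> r L (soft_dist s x y)" using assms(3) by (simp add: barrier_deriv_def)
  ultimately have "barrier_deriv \<kappa> r L (soft_dist s x y) * (1 / 2)
      \<le> barrier_deriv \<kappa> r L (soft_dist s x y) * (norm (y - x) / soft_dist s x y)"
    by (intro mult_left_mono)
  then show ?thesis using b soft_dist_pos[OF assms(1), of x y] by (simp add: radial_test_grad_def)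
qed

section \<open>Bounds for the short and the long jumps\<close>

lemma nonlocal_ball_le:
  assumes "M2 \<Omega> \<nu> \<sigma> C\<^sub>2" "\<sigma> < 1" "0 \<le> C\<^sub>2" "x \<in> closure \<Omega>" "sets (\<nu> x) = sets borel"
    and "0 < \<rho>" "\<rho> < 1" "0 \<le> B"
    and lip: "\<And>z. norm z < \<rho> \<Longrightarrow> \<phi> (x + z) - \<phi> x \<le> B * norm z"
  shows "nonlocal \<Omega> \<nu> (ball 0 \<rho>) \<phi> x \<le> B * (C\<^sub>2 * \<rho> powr (1 - \<sigma>))"
proof -
  let ?f = "\<lambda>z. indicator (ball 0 \<rho>) z * norm z :: real"
  have "?f \<in> borel_measurable borel"
    by (intro borel_measurable_times borel_measurable_indicator borel_measurable_norm) auto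
  then have f[measurable]: "?f \<in> borel_measurable (\<nu> x)"
    by (simp only: measurable_cong_sets[OF assms(5) refl])
  have "(\<integral>\<^sup>+ z. ennreal (?f z) \<partial>\<nu> x) = (\<integral>\<^sup>+ z\<in>ball 0 \<rho>. ennreal (norm z) \<partial>\<nu> x)"
    by (intro nn_integral_cong) (simp add: indicator_def)
  also have "\<dots> \<le> ennreal (C\<^sub>2 * \<rho> powr (1 - \<sigma>))"
    by (rule M2_D[OF assms(1,2,4,6,7)])
  finally have nn: "(\<integral>\<^sup>+ z. ennreal (?f z) \<partial>\<nu> x) \<le> ennreal (C\<^sub>2 * \<rho> powr (1 - \<sigma>))" .
  have int: "integrable (\<nu> x) ?f"
    using nn by (intro integrableI_nonneg) (auto simp: le_less_trans)
  have "integral\<^sup>L (\<nu> x) ?f = enn2real (\<integral>\<^sup>+ z. ennreal (?f z) \<partial>\<nu> x)"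
    by (rule integral_eq_nn_integral) auto
  also have "\<dots> \<le> C\<^sub>2 * \<rho> powr (1 - \<sigma>)"
    using nn assms(3) by (intro enn2real_leI) auto
  finally have le: "integral\<^sup>L (\<nu> x) ?f \<le> C\<^sub>2 * \<rho> powr (1 - \<sigma>)" .
  have "nonlocal \<Omega> \<nu> (ball 0 \<rho>) \<phi> x \<le> (\<integral>z. B * ?f z \<partial>\<nu> x)"
    unfolding nonlocal_def set_lebesgue_integral_def
  \<comment> \<open>Only the majorant has to be integrable: a non-integrable left side has integral
    0 by default, and the majorant is nonnegative.\<close>
  proof (rule integral_mono_AE')
    show "integrable (\<nu> x) (\<lambda>z. B * ?f z)" using int by simp
    show "AE z in \<nu> x. indicator (jump_set \<Omega> (ball 0 \<rho>) x) z *\<^sub>R (\<phi> (x + z) - \<phi> x) \<le> B * ?f z"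
      using lip assms(8) by (intro AE_I2) (auto simp: indicator_def)
    show "AE z in \<nu> x. 0 \<le> B * ?f z" using assms(8) by simp
  qed
  also have "\<dots> = B * integral\<^sup>L (\<nu> x) ?f" by simp
  also have "\<dots> \<le> B * (C\<^sub>2 * \<rho> powr (1 - \<sigma>))" using le assms(8) by (rule mult_left_mono)
  finally show ?thesis .
qed

text \<open>Almost every jump within the closure lands in \<open>\<Omega>\<close>, so a bound on
  \<open>u\<close> inside \<open>\<Omega>\<close> controls the integral, whatever the values of
  \<open>u\<close> on the frontier.\<close>

lemma nonlocal_compl_ball_le:
  assumes "M1 \<Omega> \<nu> \<sigma> C\<^sub>1" "0 < \<sigma>" "0 \<le> C\<^sub>1" "x \<in> \<Omega>" "sets (\<nu> x) = sets borel"
    and "0 < \<rho>" "0 \<le> M"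
    and null: "emeasure (\<nu> x) {z. x + z \<in> frontier \<Omega>} = 0"
    and osc: "\<And>y. y \<in> \<Omega> \<Longrightarrow> u y - u x \<le> M"
  shows "nonlocal \<Omega> \<nu> (- ball 0 \<rho>) u x \<le> M * (C\<^sub>1 * \<rho> powr (- \<sigma>))"
proof -
  let ?f = "indicator (- ball 0 \<rho>) :: 'a \<Rightarrow> real"
  have x: "x \<in> closure \<Omega>" using assms(4) closure_subset by blast
  have em: "emeasure (\<nu> x) (- ball 0 \<rho>) \<le> ennreal (C\<^sub>1 * \<rho> powr (- \<sigma>))"
    by (rule M1_D[OF assms(1,5,2) x assms(6)])
  have sp: "space (\<nu> x) = UNIV" using sets_eq_imp_space_eq[OF assms(5)] by simp
  have int: "integrable (\<nu> x) ?f"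
    using em assms(5) by (simp add: integrable_indicator_iff sp le_less_trans)
  have "integral\<^sup>L (\<nu> x) ?f = measure (\<nu> x) (- ball 0 \<rho>)" by (simp add: sp)
  also have "\<dots> \<le> C\<^sub>1 * \<rho> powr (- \<sigma>)"
    unfolding measure_def using em assms(3) by (intro enn2real_leI) auto
  finally have le: "integral\<^sup>L (\<nu> x) ?f \<le> C\<^sub>1 * \<rho> powr (- \<sigma>)" .
  have "{z. x + z \<in> frontier \<Omega>} \<in> sets borel"
  proof -
    have "(\<lambda>z. x + z) -` frontier \<Omega> \<inter> space borel \<in> sets borel"
      by (rule measurable_sets[of _ borel borel]) auto
    then show ?thesis by (simp add: vimage_def)
  qed
  then have "{z. x + z \<in> frontier \<Omega>} \<in> null_sets (\<nu> x)" using null assms(5) by auto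
  then have AE: "AE z in \<nu> x. x + z \<notin> frontier \<Omega>" by (auto dest: AE_not_in)
  have "nonlocal \<Omega> \<nu> (- ball 0 \<rho>) u x \<le> (\<integral>z. M * ?f z \<partial>\<nu> x)"
    unfolding nonlocal_def set_lebesgue_integral_def
  proof (rule integral_mono_AE')
    show "integrable (\<nu> x) (\<lambda>z. M * ?f z)" using int by simp
    show "AE z in \<nu> x. indicator (jump_set \<Omega> (- ball 0 \<rho>) x) z *\<^sub>R (u (x + z) - u x) \<le> M * ?f z"
      using AE
    proof eventually_elim
      case (elim z)
      show ?case
      proof (cases "z \<in> jump_set \<Omega> (- ball 0 \<rho>) x")
        case True
        then have "x + z \<in> \<Omega>"
          using elim interior_subset by (auto simp: frontier_def)
        then show ?thesis using True osc by simp
      qed (use assms(7) in simp)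
    qed
    show "AE z in \<nu> x. 0 \<le> M * ?f z" using assms(7) by simp
  qed
  also have "\<dots> = M * integral\<^sup>L (\<nu> x) ?f" by simp
  also have "\<dots> \<le> M * (C\<^sub>1 * \<rho> powr (- \<sigma>))" using le assms(7) by (rule mult_left_mono)
  finally show ?thesis .
qed

text \<open>The arctangent vanishes at \<open>t = r\<close>, so the rise from \<open>r / 2\<close>
  is \<open>2 * L * r / \<kappa> * arctan (1 / (2 * \<kappa>))\<close>. For
  \<open>\<kappa> \<le> 1\<close> this is at least \<open>c / \<kappa>\<close>, which exceeds any
  given \<open>K\<close> for small \<open>\<kappa>\<close>.\<close>

lemma barrier_dominates:
  assumes "0 < r" "0 < L"
  obtains \<kappa> where "0 < \<kappa>" "\<kappa> \<le> 1" "barrier \<kappa> r L (r / 2) + K < barrier \<kappa> r L r"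
proof -
  define c where "c = 2 * L * r * arctan (1 / 2)"
  have c: "0 < c" using assms by (simp add: c_def)
  define \<kappa> where "\<kappa> = min 1 (c / (\<bar>K\<bar> + 1))"
  have \<kappa>: "0 < \<kappa>" "\<kappa> \<le> 1" "\<kappa> * (\<bar>K\<bar> + 1) \<le> c"
    using c by (auto simp: \<kappa>_def pos_le_divide_eq[symmetric])
  have "K < \<bar>K\<bar> + 1" by simp
  also have "\<dots> \<le> c / \<kappa>" using \<kappa> by (simp add: field_simps)
  also have "c / \<kappa> = 2 * L * r / \<kappa> * arctan (1 / 2)" by (simp add: c_def)
  also have "\<dots> \<le> 2 * L * r / \<kappa> * arctan (1 / 2 / \<kappa>)"
    using \<kappa>(1,2) assms by (intro mult_left_mono) (auto simp: arctan_le_iff field_simps)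
  also have "\<dots> = barrier \<kappa> r L r - barrier \<kappa> r L (r / 2)"
    using assms by (simp add: barrier_def arctan_minus)
  finally show ?thesis using \<kappa> by (intro that[of \<kappa>]) auto
qed

text \<open>
  At a maximum point \<open>y\<close> of \<open>u - radial_test\<close> at distance at least \<open>s\<close> from the centre, the
  integral is split at the radius \<open>r * W / 2\<close>, \<open>W = sqrt (\<kappa>\<^sup>2 + (soft_dist s x y / r - 1)\<^sup>2)\<close>, on
  which \<open>barrier_deriv\<close> is comparable to its value \<open>2 * L / W\<^sup>2\<close> at \<open>y\<close>. As \<open>W\<^sup>2 \<le> 2\<close>, all terms of
  the viscosity inequality are at most a constant times \<open>2 / W\<^sup>2\<close>, which is below its
  \<open>m\<close>-th power on the other side.
\<close>

lemma no_touching_radial_test: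
  fixes \<Omega> :: "'a::euclidean_space set"
  assumes sub: "viscosity_subsolution \<Omega> \<nu> m b\<^sub>0 A\<^sub>0 u"
    and M12: "M1 \<Omega> \<nu> \<sigma> C\<^sub>1" "M2 \<Omega> \<nu> \<sigma> C\<^sub>2"
    and data: "0 < \<sigma>" "\<sigma> < 1" "1 < m" "0 < b\<^sub>0" "0 \<le> A\<^sub>0" "0 \<le> C\<^sub>1" "0 \<le> C\<^sub>2"
    and y: "y \<in> \<Omega>" "sets (\<nu> y) = sets borel" "emeasure (\<nu> y) {z. y + z \<in> frontier \<Omega>} = 0"
    and M: "0 \<le> M" "\<And>z. z \<in> \<Omega> \<Longrightarrow> u z - u y \<le> M"
    and r: "0 < r" "r \<le> 1" and L: "0 < L" and \<kappa>: "0 < \<kappa>" "\<kappa> \<le> 1"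
    and s: "0 < s" "s \<le> norm (y - x)" "soft_dist s x y \<le> r"
    and max: "\<And>z. z \<in> closure \<Omega> \<Longrightarrow> u z - radial_test \<kappa> r L s x z \<le> u y - radial_test \<kappa> r L s x y"
  shows "b\<^sub>0 * (L / 2) powr m \<le> A\<^sub>0 + 4 * C\<^sub>2 * L + 2 * M * C\<^sub>1 * r powr (- \<sigma>)"
proof -
  let ?\<phi> = "radial_test \<kappa> r L s x"
  let ?p = "radial_test_grad \<kappa> r L s x y"
  define t where "t = soft_dist s x y"
  define w where "w = t / r - 1"
  define W where "W = sqrt (\<kappa>\<^sup>2 + w\<^sup>2)"
  define h where "h = 2 / W\<^sup>2"
  define \<rho> where "\<rho> = r * W / 2"
  have t: "0 < t" "t \<le> r" using s soft_dist_pos by (auto simp: t_def)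
  have W2: "W\<^sup>2 = \<kappa>\<^sup>2 + w\<^sup>2" and W0: "0 < W"
    using \<kappa>(1) by (auto simp: W_def add_pos_nonneg)
  have "\<bar>w\<bar> \<le> 1" using t r(1) by (auto simp: w_def field_simps abs_le_iff)
  then have "w\<^sup>2 \<le> 1" "\<kappa>\<^sup>2 \<le> 1" using \<kappa> by (auto simp: abs_square_le_1[symmetric] power_le_one)
  then have W2': "W\<^sup>2 \<le> 2" using W2 by simp
  have W_lt: "W < 2" using W2' by (intro power2_less_imp_less[of W 2]) auto
  have h: "1 \<le> h" using W2' W0 by (simp add: h_def)
  have \<rho>: "0 < \<rho>" "\<rho> < 1"
  proof -
    show "0 < \<rho>" using r W0 by (simp add: \<rho>_def)
    have "r * W \<le> 1 * W" using r W0 by (intro mult_right_mono) auto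
    then show "\<rho> < 1" using W_lt by (simp add: \<rho>_def)
  qed
  have Hd: "barrier_deriv \<kappa> r L t = L * h" by (simp add: barrier_deriv_def h_def W2 w_def)
  have y': "y \<in> closure \<Omega>" using y(1) closure_subset by blast
  have lip: "?\<phi> (y + z) - ?\<phi> y \<le> 4 * (L * h) * norm z" if z: "norm z < \<rho>" for z
  proof -
    have d: "\<bar>soft_dist s x (y + z) - t\<bar> \<le> norm z"
      using soft_dist_lipschitz[of s x "y + z" y] by (simp add: t_def)
    have "\<bar>barrier \<kappa> r L (soft_dist s x (y + z)) - barrier \<kappa> r L t\<bar>
        \<le> 4 * (L * h) * \<bar>soft_dist s x (y + z) - t\<bar>"
    proof (rule barrier_lipschitz[where S="cball t \<rho>"])
      show "\<bar>barrier_deriv \<kappa> r L v\<bar> \<le> 4 * (L * h)" if "v \<in> cball t \<rho>" for v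
        using barrier_deriv_doubling[of \<kappa> r L v t] that \<kappa>(1) r(1) L
        by (simp add: Hd \<rho>_def W_def w_def dist_real_def abs_minus_commute)
    qed (use \<kappa> r d z \<rho> in \<open>auto simp: dist_real_def abs_minus_commute\<close>)
    also have "\<dots> \<le> 4 * (L * h) * norm z" using d L h by (intro mult_left_mono) auto
    finally show ?thesis by (simp add: radial_test_def t_def)
  qed
  have I1: "nonlocal \<Omega> \<nu> (ball 0 \<rho>) ?\<phi> y \<le> 4 * (L * h) * (C\<^sub>2 * \<rho> powr (1 - \<sigma>))"
    by (rule nonlocal_ball_le[OF M12(2) data(2,7) y' y(2) \<rho> _ lip]) (use L h in auto)
  have "\<rho> powr (1 - \<sigma>) \<le> 1" using \<rho> data(2) by (intro powr_le1) auto
  then have "C\<^sub>2 * \<rho> powr (1 - \<sigma>) \<le> C\<^sub>2" using data(7) mult_left_le by blast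
  then have "4 * (L * h) * (C\<^sub>2 * \<rho> powr (1 - \<sigma>)) \<le> 4 * (L * h) * C\<^sub>2"
    using L h by (intro mult_left_mono) auto
  then have I1': "nonlocal \<Omega> \<nu> (ball 0 \<rho>) ?\<phi> y \<le> h * (4 * C\<^sub>2 * L)"
    using I1 by (simp add: algebra_simps)
  have I2: "nonlocal \<Omega> \<nu> (- ball 0 \<rho>) u y \<le> M * (C\<^sub>1 * \<rho> powr (- \<sigma>))"
    by (rule nonlocal_compl_ball_le[OF M12(1) data(1,6) y(1,2) \<rho>(1) M(1) y(3), where u=u, OF M(2)])
  \<comment> \<open>As \<open>W / 2 < 1\<close> and \<open>\<sigma> < 1\<close>, the power with
    exponent \<open>- \<sigma>\<close> is at most \<open>2 / W\<close>, and this is at most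
    \<open>4 / W\<^sup>2 = 2 * h\<close> because \<open>W < 2\<close>.\<close>
  have "\<rho> powr (- \<sigma>) \<le> 2 * h * r powr (- \<sigma>)"
  proof -
    have "(W / 2) powr (- \<sigma>) \<le> (W / 2) powr (- 1)"
      using W0 W_lt data(2) by (intro powr_mono') auto
    also have "\<dots> = 2 / W" using W0 by (simp add: powr_minus_divide)
    also have "\<dots> \<le> 2 * h" using W0 W_lt by (simp add: h_def power2_eq_square field_simps)
    finally have "(W / 2) powr (- \<sigma>) \<le> 2 * h" .
    moreover have "\<rho> powr (- \<sigma>) = r powr (- \<sigma>) * (W / 2) powr (- \<sigma>)"
      using r(1) W0 by (simp add: \<rho>_def powr_mult[symmetric])
    ultimately show ?thesis
      using mult_left_mono[of "(W / 2) powr (- \<sigma>)" "2 * h" "r powr (- \<sigma>)"] by (simp add: mult.commute)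
  qed
  then have "M * (C\<^sub>1 * \<rho> powr (- \<sigma>)) \<le> M * (C\<^sub>1 * (2 * h * r powr (- \<sigma>)))"
    using M(1) data(6) by (intro mult_left_mono)
  then have I2': "nonlocal \<Omega> \<nu> (- ball 0 \<rho>) u y \<le> h * (2 * M * C\<^sub>1 * r powr (- \<sigma>))"
    using I2 by (simp add: algebra_simps)
  have "GDERIV ?\<phi> y :> ?p"
    unfolding gderiv_def by (rule radial_test_has_derivative[OF \<kappa>(1) r(1) s(1)])
  then have visc: "- nonlocal \<Omega> \<nu> (ball 0 \<rho>) ?\<phi> y - nonlocal \<Omega> \<nu> (- ball 0 \<rho>) u y
      + b\<^sub>0 * norm ?p powr m \<le> A\<^sub>0"
    using sub C1_on_radial_test[OF \<kappa>(1) r(1) s(1)] y(1) max \<rho>(1)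
    unfolding viscosity_subsolution_def by blast
  have "L / 2 * h \<le> norm ?p"
    using norm_radial_test_grad_ge[OF s(1,2), of L \<kappa> r] L by (simp add: t_def[symmetric] Hd)
  then have "(L / 2 * h) powr m \<le> norm ?p powr m" using L h data(3) by (intro powr_mono2) auto
  moreover have "(L / 2 * h) powr m = (L / 2) powr m * h powr m"
    using L h by (simp add: powr_mult powr_divide)
  moreover have "h \<le> h powr m" using powr_mono[of 1 m h] h data(3) by simp
  then have "(L / 2) powr m * h \<le> (L / 2) powr m * h powr m" by (intro mult_left_mono) auto
  ultimately have "(L / 2) powr m * h \<le> norm ?p powr m" by linarith
  then have "b\<^sub>0 * ((L / 2) powr m * h) \<le> b\<^sub>0 * norm ?p powr m" using data(4) by (intro mult_left_mono) auto
  moreover have "A\<^sub>0 \<le> h * A\<^sub>0" using h data(5) mult_right_mono[of 1 h A\<^sub>0] by simp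
  ultimately have "b\<^sub>0 * ((L / 2) powr m * h) \<le> h * A\<^sub>0 + h * (4 * C\<^sub>2 * L) + h * (2 * M * C\<^sub>1 * r powr (- \<sigma>))"
    using visc I1' I2' by linarith
  \<comment> \<open>Dividing by \<open>h\<close> removes \<open>\<kappa>\<close> and the position of
    \<open>y\<close> from the inequality.\<close>
  then have "h * (b\<^sub>0 * (L / 2) powr m) \<le> h * (A\<^sub>0 + 4 * C\<^sub>2 * L + 2 * M * C\<^sub>1 * r powr (- \<sigma>))"
    by (simp add: algebra_simps)
  then show ?thesis using h by (simp add: mult_le_cancel_left)
qed

text \<open>The steep barrier confines the maximum point of \<open>u - radial_test\<close> to
  \<open>ball x r\<close>, and \<open>big\<close> excludes touching at distance at least
  \<open>s\<close> from \<open>x\<close>. So it lies within \<open>s\<close> of \<open>x\<close>,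
  where semicontinuity gives \<open>u \<le> u x + \<eta>\<close>. Comparison with the value at
  \<open>y\<close> leaves only the variation of the barrier on \<open>{0..r / 2}\<close>.\<close>

proposition subsolution_interior_estimate:
  fixes \<Omega> :: "'a::euclidean_space set"
  assumes \<Omega>: "bounded \<Omega>"
    and sub: "viscosity_subsolution \<Omega> \<nu> m b\<^sub>0 A\<^sub>0 u"
    and M12: "M1 \<Omega> \<nu> \<sigma> C\<^sub>1" "M2 \<Omega> \<nu> \<sigma> C\<^sub>2"
    and data: "0 < \<sigma>" "\<sigma> < 1" "1 < m" "0 < b\<^sub>0" "0 \<le> A\<^sub>0" "0 \<le> C\<^sub>1" "0 \<le> C\<^sub>2"
    and \<nu>: "\<And>y. y \<in> \<Omega> \<Longrightarrow> sets (\<nu> y) = sets borel"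
      "\<And>y. y \<in> \<Omega> \<Longrightarrow> emeasure (\<nu> y) {z. y + z \<in> frontier \<Omega>} = 0"
    and u: "bounded (u ` closure \<Omega>)" "0 \<le> M" "\<And>y z. y \<in> \<Omega> \<Longrightarrow> z \<in> \<Omega> \<Longrightarrow> u z - u y \<le> M"
    and r: "0 < r" "r \<le> 1" "ball x r \<subseteq> \<Omega>" and L: "0 < L"
    and big: "A\<^sub>0 + 4 * C\<^sub>2 * L + 2 * M * C\<^sub>1 * r powr (- \<sigma>) < b\<^sub>0 * (L / 2) powr m"
    and xy: "dist x y \<le> r / 4"
  shows "u y \<le> u x + 4 * L * r"
proof (rule field_le_epsilon)
  fix \<eta> :: real assume \<eta>: "0 < \<eta>"
  have sub_cl: "ball x r \<subseteq> closure \<Omega>" using r(3) closure_subset by blast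
  then have x: "x \<in> closure \<Omega>" using r(1) by auto
  have yb: "y \<in> closure \<Omega>" using xy r(1) sub_cl by (auto simp: subset_iff)
  obtain K where K: "\<And>z. z \<in> closure \<Omega> \<Longrightarrow> \<bar>u z\<bar> \<le> K"
    using u(1) unfolding bounded_iff by auto
  have usc: "usc_on (closure \<Omega>) u" using sub by (simp add: viscosity_subsolution_def)
  then have "\<forall>\<^sub>F z in at x within closure \<Omega>. u z < u x + \<eta>"
    using x \<eta> unfolding usc_on_def by simp
  then obtain d where d: "0 < d" "\<And>z. z \<in> closure \<Omega> \<Longrightarrow> z \<noteq> x \<Longrightarrow> dist z x < d \<Longrightarrow> u z < u x + \<eta>"
    unfolding eventually_at by blast
  \<comment> \<open>The bound \<open>d\<close> serves semicontinuity at \<open>x\<close>; the bound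
    \<open>r / 4\<close> gives \<open>soft_dist s x y \<le> r / 2\<close>.\<close>
  define s where "s = min d (r / 4)"
  have s: "0 < s" "s \<le> d" "s \<le> r / 4" using d r by (auto simp: s_def)
  \<comment> \<open>\<open>2 * K\<close> bounds differences of \<open>u\<close> on the whole
    closure, frontier included, so no maximum point can have \<open>soft_dist\<close> at least
    \<open>r\<close>.\<close>
  obtain \<kappa> where \<kappa>: "0 < \<kappa>" "\<kappa> \<le> 1" "barrier \<kappa> r L (r / 2) + 2 * K < barrier \<kappa> r L r"
    using barrier_dominates[OF r(1) L] by metis
  let ?\<phi> = "radial_test \<kappa> r L s x"
  have mono: "barrier \<kappa> r L a \<le> barrier \<kappa> r L b" if "a \<le> b" for a b
    using barrier_mono[OF \<kappa>(1) r(1) _ that] L by simp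
  have "continuous_on (closure \<Omega>) ?\<phi>"
    using radial_test_has_derivative[OF \<kappa>(1) r(1) s(1)] by (rule has_derivative_continuous_on)
  then obtain x\<^sub>0 where x0: "x\<^sub>0 \<in> closure \<Omega>" "\<And>z. z \<in> closure \<Omega> \<Longrightarrow> u z - ?\<phi> z \<le> u x\<^sub>0 - ?\<phi> x\<^sub>0"
    using usc_diff_attains_max[OF _ _ usc] \<Omega> x by (metis compact_closure empty_iff)
  have "soft_dist s x x = s" using s(1) by (simp add: soft_dist_def)
  then have "?\<phi> x \<le> barrier \<kappa> r L (r / 2)" unfolding radial_test_def by (intro mono) (use s r in auto)
  then have "?\<phi> x\<^sub>0 < barrier \<kappa> r L r"
    using x0(2)[OF x] K[OF x] K[OF x0(1)] \<kappa>(3) by linarith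
  then have t: "soft_dist s x x\<^sub>0 < r" unfolding radial_test_def using mono by (meson not_le)
  then have "dist x x\<^sub>0 < r" using soft_dist_ge[of x\<^sub>0 x s] by (simp add: dist_norm norm_minus_commute)
  then have x0_in: "x\<^sub>0 \<in> \<Omega>" using r(3) by auto
  have near: "norm (x\<^sub>0 - x) < s"
  proof (rule ccontr)
    assume "\<not> norm (x\<^sub>0 - x) < s"
    then have "b\<^sub>0 * (L / 2) powr m \<le> A\<^sub>0 + 4 * C\<^sub>2 * L + 2 * M * C\<^sub>1 * r powr (- \<sigma>)"
      using no_touching_radial_test[OF sub M12 data x0_in \<nu>(1)[OF x0_in] \<nu>(2)[OF x0_in] u(2)
          u(3)[OF x0_in] r(1,2) L \<kappa>(1,2) s(1) _ _ x0(2)] t by simp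
    then show False using big by simp
  qed
  then have "u x\<^sub>0 \<le> u x + \<eta>"
    using d(2)[OF x0(1)] s(2) \<eta> by (cases "x\<^sub>0 = x") (auto simp: dist_norm)
  moreover have "?\<phi> y - ?\<phi> x\<^sub>0 \<le> 4 * L * r"
  proof -
    have "soft_dist s x y \<le> r / 2"
      using soft_dist_le[of s x y] s xy by (simp add: dist_norm norm_minus_commute)
    then have "?\<phi> y \<le> barrier \<kappa> r L (r / 2)" unfolding radial_test_def by (rule mono)
    moreover have "barrier \<kappa> r L 0 \<le> ?\<phi> x\<^sub>0"
      unfolding radial_test_def by (intro mono) (simp add: soft_dist_def)
    moreover have "\<bar>barrier \<kappa> r L (r / 2) - barrier \<kappa> r L 0\<bar> \<le> 8 * L * \<bar>r / 2 - 0\<bar>"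
    \<comment> \<open>On this interval \<open>1 - v / r\<close> is at least \<open>1 / 2\<close>, so
      the slope is at most \<open>2 * L / (1 / 4) = 8 * L\<close> for every
      \<open>\<kappa>\<close>.\<close>
    proof (rule barrier_lipschitz[where S="{0..r / 2}"])
      fix v assume v: "v \<in> {0..r / 2}"
      then have "1 / 2 \<le> 1 - v / r" using r(1) by (simp add: field_simps)
      then have "(1 / 2)\<^sup>2 \<le> (1 - v / r)\<^sup>2" by (intro power_mono) auto
      then have *: "1 / 4 \<le> \<kappa>\<^sup>2 + (v / r - 1)\<^sup>2"
        by (simp add: power2_commute[of 1] power_divide add_increasing)
      then have "2 * L / (\<kappa>\<^sup>2 + (v / r - 1)\<^sup>2) \<le> 2 * L / (1 / 4)"
        using L by (intro divide_left_mono) auto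
      then show "\<bar>barrier_deriv \<kappa> r L v\<bar> \<le> 8 * L"
        using L * by (simp add: barrier_deriv_def)
    qed (use \<kappa> r in auto)
    ultimately show ?thesis using r(1) by simp
  qed
  ultimately show "u y \<le> u x + 4 * L * r + \<eta>" using x0(2)[OF yb] by linarith
qed

section \<open>The oscillation bound\<close>

lemma osc_boundary_limsup_le:
  fixes \<Omega> :: "'a::euclidean_space set"
  assumes "open \<Omega>" "\<Omega> \<noteq> {}" "\<And>y. y \<in> \<Omega> \<Longrightarrow> lo \<le> u y \<and> u y \<le> hi"
  shows "osc (closure \<Omega>) (boundary_limsup \<Omega> u) \<le> hi - lo"
proof -
  have bnd: "lo \<le> boundary_limsup \<Omega> u x \<and> boundary_limsup \<Omega> u x \<le> hi" if x: "x \<in> closure \<Omega>" for x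
  proof (cases "x \<in> \<Omega>")
    case True
    then show ?thesis using assms(3) by (simp add: boundary_limsup_def)
  next
    case False
    let ?F = "at x within \<Omega>" and ?L = "Limsup (at x within \<Omega>) (\<lambda>y. ereal (u y))"
    have ev: "\<forall>\<^sub>F y in ?F. y \<in> \<Omega>" by (simp add: eventually_at_filter)
    have "x islimpt \<Omega>" using x False by (simp add: closure_def)
    then have nt: "\<not> trivial_limit ?F" by (simp add: trivial_limit_within)
    have "?L \<le> ereal hi"
      using ev assms(3) by (intro Limsup_bounded) (auto elim!: eventually_mono)
    moreover have "ereal lo \<le> Liminf ?F (\<lambda>y. ereal (u y))"
      using ev assms(3) by (intro Liminf_bounded) (auto elim!: eventually_mono)
    then have "ereal lo \<le> ?L" using Liminf_le_Limsup[OF nt] order_trans by blast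
    \<comment> \<open>Between \<open>lo\<close> and \<open>hi\<close> the limit superior is finite,
      so \<open>real_of_ereal\<close> does not return its default value 0.\<close>
    ultimately show ?thesis
      using False by (cases ?L) (auto simp: boundary_limsup_def)
  qed
  have "closure \<Omega> \<noteq> {}" using assms(2) by simp
  then have "(SUP x\<in>closure \<Omega>. boundary_limsup \<Omega> u x) \<le> hi" "lo \<le> (INF x\<in>closure \<Omega>. boundary_limsup \<Omega> u x)"
    using bnd by (auto intro: cSUP_least cINF_greatest)
  then show ?thesis by (simp add: osc_def)
qed

lemma exists_superlinear_threshold:
  fixes m b A B D :: real
  assumes "1 < m" "0 < b" "0 \<le> A" "0 \<le> B" "0 \<le> D"
  obtains \<Lambda> where "0 < \<Lambda>" "A + B * \<Lambda> + D < b * (\<Lambda> / 2) powr m"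
proof -
  define S where "S = A + 2 * B + D"
  \<comment> \<open>This choice gives \<open>b * t powr m = t * (S + b)\<close>, strictly above
    \<open>t * S\<close>; the witness is \<open>2 * t\<close>, whence the factor 2 in
    \<open>S\<close>.\<close>
  define t where "t = (S / b + 1) powr (1 / (m - 1))"
  have S: "0 \<le> S" using assms by (simp add: S_def)
  have t: "1 \<le> t" unfolding t_def using S assms by (intro ge_one_powr_ge_zero) auto
  have "t powr m = t * t powr (m - 1)"
    using t by (simp add: powr_diff)
  also have "t powr (m - 1) = S / b + 1" using S assms by (simp add: t_def powr_powr)
  finally have "b * t powr m = t * S + t * b" using assms(2) by (simp add: field_simps)
  moreover have "t * S \<ge> A + B * (2 * t) + D"
    using mult_right_mono[OF t assms(3)] mult_right_mono[OF t assms(5)] by (simp add: S_def algebra_simps)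
  moreover have "0 < t * b" using t assms by simp
  ultimately show ?thesis using t by (intro that[of "2 * t"]) auto
qed

theorem corollary3p4:
  fixes \<Omega> :: "'a::euclidean_space set"
    and \<sigma> m b\<^sub>0 A\<^sub>0 C\<^sub>1 C\<^sub>2 :: real
  assumes "bounded \<Omega>" and "C1_domain \<Omega>"
    and "0 < \<sigma>" and "\<sigma> < 1"
    and "m > 1" and "b\<^sub>0 > 0" and "A\<^sub>0 \<ge> 0"
    and "C\<^sub>1 > 0" and "C\<^sub>2 > 0"
  shows "\<exists>C>0. \<forall>(\<nu> :: 'a \<Rightarrow> 'a measure) (u :: 'a \<Rightarrow> real).
           (\<forall>x\<in>closure \<Omega>. regular_jump_measure (\<nu> x)) \<and>
           M0 \<Omega> \<nu> \<and> M1 \<Omega> \<nu> \<sigma> C\<^sub>1 \<and> M2 \<Omega> \<nu> \<sigma> C\<^sub>2 \<and>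
           bounded (u ` closure \<Omega>) \<and> viscosity_subsolution \<Omega> \<nu> m b\<^sub>0 A\<^sub>0 u \<longrightarrow>
           osc (closure \<Omega>) (boundary_limsup \<Omega> u) \<le> C"
proof -
  have \<Omega>: "open \<Omega>" "connected \<Omega>" "\<Omega> \<noteq> {}" "C1_boundary \<Omega>"
    using assms(2) by (auto simp: C1_domain_def)
  define a where "a = 1 - \<sigma> / m"
  have a: "0 < a" using assms(3-5) by (simp add: a_def)
  obtain G where G: "0 \<le> G" "\<And>K v x y. 0 \<le> K \<Longrightarrow> interior_holder \<Omega> a K v \<Longrightarrow> x \<in> \<Omega> \<Longrightarrow> y \<in> \<Omega> \<Longrightarrow>
      \<bar>v x - v y\<bar> \<le> G * K"
    using interior_holder_osc_bound[OF assms(1) \<Omega>(1,2,4) a] by metis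
  \<comment> \<open>The slope condition for \<open>N = 1\<close> and \<open>r = 1\<close>. It is
    solved before \<open>\<nu>\<close> and \<open>u\<close> are introduced, so
    \<open>\<Lambda>\<close> depends on the data only.\<close>
  obtain \<Lambda> where \<Lambda>: "0 < \<Lambda>" "A\<^sub>0 + 4 * C\<^sub>2 * \<Lambda> + 2 * C\<^sub>1 < b\<^sub>0 * (\<Lambda> / 2) powr m"
    using exists_superlinear_threshold[of m b\<^sub>0 A\<^sub>0 "4 * C\<^sub>2" "2 * C\<^sub>1"] assms by auto
  define c where "c = G * (4 * \<Lambda>)"
  have c: "0 \<le> c" using G(1) \<Lambda>(1) by (simp add: c_def)
  show ?thesis
  proof (intro exI[of _ "(1 + c) powr (m / (m - 1))"] conjI allI impI)
    show "0 < (1 + c) powr (m / (m - 1))" using c by simp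
    fix \<nu> :: "'a \<Rightarrow> 'a measure" and u :: "'a \<Rightarrow> real"
    assume "(\<forall>x\<in>closure \<Omega>. regular_jump_measure (\<nu> x)) \<and>
      M0 \<Omega> \<nu> \<and> M1 \<Omega> \<nu> \<sigma> C\<^sub>1 \<and> M2 \<Omega> \<nu> \<sigma> C\<^sub>2 \<and>
      bounded (u ` closure \<Omega>) \<and> viscosity_subsolution \<Omega> \<nu> m b\<^sub>0 A\<^sub>0 u"
    then have sets: "\<And>x. x \<in> closure \<Omega> \<Longrightarrow> sets (\<nu> x) = sets borel"
      and M: "M0 \<Omega> \<nu>" "M1 \<Omega> \<nu> \<sigma> C\<^sub>1" "M2 \<Omega> \<nu> \<sigma> C\<^sub>2"
      and u: "bounded (u ` closure \<Omega>)" "viscosity_subsolution \<Omega> \<nu> m b\<^sub>0 A\<^sub>0 u"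
      by (auto simp: regular_jump_measure_def)
    have sets': "sets (\<nu> x) = sets borel" if "x \<in> \<Omega>" for x
      using that sets closure_subset by blast
    have null: "emeasure (\<nu> x) {z. x + z \<in> frontier \<Omega>} = 0" if "x \<in> \<Omega>" for x
      using jump_measure_frontier_eq_0[OF \<Omega>(1) negligible_frontier_C1_boundary[OF \<Omega>(1,4)] sets M(1,2) assms(3) that] .
    define hi lo where "hi = (SUP x\<in>\<Omega>. u x)" and "lo = (INF x\<in>\<Omega>. u x)"
    have "bounded (u ` \<Omega>)" using u(1) by (rule bounded_subset) (use closure_subset in blast)
    then have hi_lo: "u x \<le> hi" "lo \<le> u x" if "x \<in> \<Omega>" for x
      using that unfolding hi_def lo_def
      by (auto intro!: cSUP_upper cINF_lower bounded_imp_bdd_above bounded_imp_bdd_below)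
    \<comment> \<open>The added 1 gives \<open>1 \<le> N\<close>, so that both
      \<open>A\<^sub>0\<close> and \<open>N powr (1 / m)\<close> can be absorbed into multiples of
      \<open>N\<close>.\<close>
    define N where "N = 1 + (hi - lo)"
    have diff: "u z - u y \<le> hi - lo" if "y \<in> \<Omega>" "z \<in> \<Omega>" for y z
      using hi_lo(2)[OF that(1)] hi_lo(1)[OF that(2)] by simp
    have N: "1 \<le> N" using \<Omega>(3) diff by (fastforce simp: N_def)
    have N_root: "1 \<le> N powr (1 / m)" "N powr (1 / m) \<le> N"
      using N assms(5) powr_mono[of "1 / m" 1 N] by (auto intro: ge_one_powr_ge_zero)
    let ?K = "4 * \<Lambda> * N powr (1 / m)"
    have one_sided: "u y \<le> u x + ?K * r powr a"
      if r: "0 < r" "r \<le> 1" "ball x r \<subseteq> \<Omega>" "dist x y \<le> r / 4" for x y r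
    proof -
      \<comment> \<open>With this scaling
        \<open>(L / 2) powr m = (\<Lambda> / 2) powr m * N * R\<close>, while each term on the other
        side is at most \<open>N * R\<close> times its counterpart in the choice of
        \<open>\<Lambda>\<close>.\<close>
      define L where "L = \<Lambda> * N powr (1 / m) * r powr (- (\<sigma> / m))"
      define R where "R = r powr (- \<sigma>)"
      have L: "0 < L" using \<Lambda>(1) N r(1) by (simp add: L_def)
      have R: "1 \<le> R" using powr_mono'[of "- \<sigma>" 0 r] r assms(3) by (simp add: R_def)
      then have NR: "1 \<le> N * R" using N mult_mono[of 1 N 1 R] by simp
      have "r powr (- (\<sigma> / m)) \<le> R"
        unfolding R_def using r assms(3,5) by (intro powr_mono') (auto simp: field_simps)
      then have "L \<le> \<Lambda> * (N * R)"
        unfolding L_def mult.assoc using N_root R \<Lambda>(1) N by (intro mult_left_mono mult_mono) auto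
      then have "4 * C\<^sub>2 * L \<le> 4 * C\<^sub>2 * (\<Lambda> * (N * R))" using assms(9) by (intro mult_left_mono) auto
      moreover have "A\<^sub>0 \<le> A\<^sub>0 * (N * R)" using mult_left_mono[OF NR assms(7)] by simp
      moreover have "(hi - lo) * (C\<^sub>1 * R) \<le> N * (C\<^sub>1 * R)"
        using assms(8) R by (intro mult_right_mono) (auto simp: N_def)
      ultimately have "A\<^sub>0 + 4 * C\<^sub>2 * L + 2 * (hi - lo) * C\<^sub>1 * R
          \<le> (A\<^sub>0 + 4 * C\<^sub>2 * \<Lambda> + 2 * C\<^sub>1) * (N * R)"
        by (simp add: algebra_simps)
      also have "\<dots> < b\<^sub>0 * (\<Lambda> / 2) powr m * (N * R)"
        using \<Lambda>(2) NR by (intro mult_strict_right_mono) auto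
      also have "\<dots> = b\<^sub>0 * (L / 2) powr m"
      proof -
        have "(L / 2) powr m = (\<Lambda> / 2) powr m * N * R"
          using \<Lambda>(1) N r(1) assms(5) by (simp add: L_def R_def powr_mult powr_divide powr_powr)
        then show ?thesis by simp
      qed
      finally have big: "A\<^sub>0 + 4 * C\<^sub>2 * L + 2 * (hi - lo) * C\<^sub>1 * r powr (- \<sigma>) < b\<^sub>0 * (L / 2) powr m"
        by (simp add: R_def)
      have "u y \<le> u x + 4 * L * r"
        by (rule subsolution_interior_estimate[OF assms(1) u(2) M(2,3) _ _ _ _ _ _ _ sets' null u(1) _ diff r(1-3) L big r(4)])
          (use assms N in \<open>auto simp: N_def\<close>)
      also have "4 * L * r = ?K * (r powr (- (\<sigma> / m)) * r powr 1)" using r(1) by (simp add: L_def)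
      also have "r powr (- (\<sigma> / m)) * r powr 1 = r powr a" by (simp only: powr_add[symmetric] a_def) simp
      finally show ?thesis .
    qed
    have "interior_holder \<Omega> a ?K u"
      unfolding interior_holder_def
    proof (intro allI impI)
      fix x y :: 'a and r :: real
      assume r: "0 < r" "r \<le> 1" "ball x r \<subseteq> \<Omega>" "dist x y \<le> r / 8"
      \<comment> \<open>The estimate is one-sided; the opposite inequality comes from applying it
        about \<open>y\<close> with radius \<open>r / 2\<close>.\<close>
      have "ball y (r / 2) \<subseteq> ball x r"
        using r by (simp add: ball_subset_ball_iff dist_commute)
      then have "u x \<le> u y + ?K * (r / 2) powr a"
        using r by (intro one_sided) (auto simp: dist_commute)
      also have "?K * (r / 2) powr a \<le> ?K * r powr a"
        using r \<Lambda>(1) a by (intro mult_left_mono powr_mono2) auto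
      finally have "u x \<le> u y + ?K * r powr a" by simp
      moreover have "u y \<le> u x + ?K * r powr a" using r by (intro one_sided) auto
      ultimately show "\<bar>u x - u y\<bar> \<le> ?K * r powr a" by linarith
    qed
    then have "\<bar>u x - u y\<bar> \<le> G * ?K" if "x \<in> \<Omega>" "y \<in> \<Omega>" for x y
      using that \<Lambda>(1) by (intro G(2)) auto
    then have le: "u x \<le> u y + c * N powr (1 / m)" if "x \<in> \<Omega>" "y \<in> \<Omega>" for x y
      using that by (force simp: c_def abs_le_iff algebra_simps)
    have "hi \<le> u y + c * N powr (1 / m)" if "y \<in> \<Omega>" for y
      unfolding hi_def using \<Omega>(3) le that by (intro cSUP_least) auto
    then have "hi - c * N powr (1 / m) \<le> lo"
      unfolding lo_def using \<Omega>(3) by (intro cINF_greatest) (auto simp: algebra_simps)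
    \<comment> \<open>The power on the right is sublinear since \<open>m > 1\<close>; dividing by it
      bounds \<open>N powr (1 - 1 / m)\<close>, and \<open>m / (m - 1)\<close> is the reciprocal of
      that exponent.\<close>
    then have "N \<le> (1 + c) * N powr (1 / m)" using N_root(1) by (simp add: N_def algebra_simps)
    then have "N / N powr (1 / m) \<le> 1 + c" using N_root(1) by (intro pos_divide_le_eq[THEN iffD2]) auto
    then have "N powr (1 - 1 / m) \<le> 1 + c" using N by (simp add: powr_diff)
    then have "(N powr (1 - 1 / m)) powr (m / (m - 1)) \<le> (1 + c) powr (m / (m - 1))"
      using assms(5) by (intro powr_mono2) auto
    moreover have "(N powr (1 - 1 / m)) powr (m / (m - 1)) = N"
    proof -
      have "(1 - 1 / m) * (m / (m - 1)) = 1" using assms(5) by (simp add: field_simps)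
      then show ?thesis unfolding powr_powr using N by (simp only:) simp
    qed
    ultimately have "N \<le> (1 + c) powr (m / (m - 1))" by simp
    moreover have "osc (closure \<Omega>) (boundary_limsup \<Omega> u) \<le> hi - lo"
      using \<Omega>(1,3) hi_lo by (intro osc_boundary_limsup_le) auto
    ultimately show "osc (closure \<Omega>) (boundary_limsup \<Omega> u) \<le> (1 + c) powr (m / (m - 1))"
      by (simp add: N_def)
  qed
qed

end
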